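(* For $|z|<\pi$, \[ \sum_{n\geq 1}^{\mathcal{R}}e^{nz}\log n+e^{z}\sum_{n\geq 1}^{\mathcal{R}}e^{-nz}H_{n}=\gamma \left(\frac{e^{z}}{1-e^{-z}}-\frac{1}{z}\right)\ \operatorname{mod}\ \mathbb{Q}[[z]], \] i.e. the difference of the two sides (the right side being analytic at $z=0$ after removing its removable singularity) is given on $|z|<\pi$ by a power series in $z$ with rational coefficients.
   Context: Ramanujan summation: let $a$ be analytic on $P=\{x:\operatorname{Re}x>0\}$ with $|a(x)|\le Ke^{\alpha|x|}$ on $P$ for some $\alpha<\pi$, $K>0$. There is a unique function $R_a$ analytic on $P$ with $R_a(x)-R_a(x+1)=a(x)$, $|R_a(x)|\le Le^{\beta|x|}$ on $P$ for some $\beta<2\pi$, $L>0$, and $\int_1^2R_a(t)\,dt=0$. One defines $\sum_{n\ge1}^{\mathcal R}a(n):=R_a(1)$. The summands are $a(x)=e^{xz}\log x$ and $a(x)=e^{-xz}(\psi(x+1)+\gamma)$ (the latter interpolating $e^{-nz}H_n$, where $H_n=\sum_{j=1}^n1/j$). $\psi$ is the digamma function and $\gamma$ is Euler's constant.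
   Formalization: The growth bounds on a and R_a are required only on some half-plane Re x > c with 0 ≤ c < 1, not on all of P: e^{xz} log x is unbounded near 0, so under the bound on P its Ramanujan sum would be undefined. Where the literal sum exists, the two agree. *)

theory Defs
  imports "HOL-Complex_Analysis.Complex_Analysis"
begin

definition right_half_plane :: "complex set" where
  "right_half_plane = {x. 0 < Re x}"

text \<open>
  The bound is required on some half-plane \<open>Re x > c\<close> with \<open>0 \<le> c < 1\<close>. The case \<open>c = 0\<close> is
  the bound on all of \<open>Re x > 0\<close>. That case alone would exclude \<open>exp (x * z) * ln x\<close>, which is
  unbounded near \<open>0\<close>, from the functions that can be summed.
\<close>

definition exp_type_less :: "real \<Rightarrow> (complex \<Rightarrow> complex) \<Rightarrow> bool" where
  "exp_type_less \<rho> f \<longleftrightarrow>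
     (\<exists>c \<alpha> K. 0 \<le> c \<and> c < 1 \<and> \<alpha> < \<rho> \<and> 0 < K \<and>
        (\<forall>x. c < Re x \<longrightarrow> norm (f x) \<le> K * exp (\<alpha> * norm x)))"

definition ramanujan_admissible :: "(complex \<Rightarrow> complex) \<Rightarrow> bool" where
  "ramanujan_admissible a \<longleftrightarrow> a holomorphic_on right_half_plane \<and> exp_type_less pi a"

definition ramanujan_remainder :: "(complex \<Rightarrow> complex) \<Rightarrow> (complex \<Rightarrow> complex) \<Rightarrow> bool" where
  "ramanujan_remainder a R \<longleftrightarrow>
     R holomorphic_on right_half_plane \<and>
     (\<forall>x\<in>right_half_plane. R x - R (x + 1) = a x) \<and>
     exp_type_less (2 * pi) R \<and>
     ((\<lambda>t::real. R (of_real t)) has_integral 0) {1..2}"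

text \<open>
  The remainder is unique only as a function on the half-plane, its values elsewhere being
  arbitrary, so the description operator is applied to its value at \<open>1\<close>.
\<close>

definition ramanujan_sum :: "(complex \<Rightarrow> complex) \<Rightarrow> complex" where
  "ramanujan_sum a = (THE s. ramanujan_admissible a \<and> (\<exists>R. ramanujan_remainder a R \<and> R 1 = s))"

definition harm_interp :: "complex \<Rightarrow> complex" where
  "harm_interp x = Digamma (x + 1) + euler_mascheroni"

lemma harm_interp_of_nat: "harm_interp (of_nat n) = harm n"
  using Digamma_of_nat[of n, where 'a = complex]
  by (simp add: harm_interp_def add.commute)

end

(*
  For norm z < 2 * pi the remainder of exp (x * z) / x is E z x = I z x - Digamma x, where I z x is
  a power series in z whose coefficients are rational polynomials in x (essentially Bernoulli
  polynomials), obtained by integrating the remainder of exp (x * z) in z.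

  The remainder A of exp (x * z) * ln x satisfies A' - z A = E z: the two sides have the same
  differences, hence differ by a constant, which is A 2 - A 1 = - ln 1 = 0 after integration
  over [1, 2]. Integrating exp (- x z) E z x over [1, 2] gives A 1 in terms of the transform D z
  = integral of exp (- t z) Digamma t over [1, 2], up to the integral of exp (- t z) I z t,
  which is a power series in z with rational coefficients. Summation by parts, with harm_interp
  x - harm_interp (x - 1) = 1 / x, expresses the remainder of exp (- x z) * harm_interp x
  through E (- z), and its normalisation produces the same D z with the opposite sign. The
  transcendental parts cancel, except for the multiple of euler_mascheroni that comes from E (-
  z) 1 and from the constant in harm_interp.
*)
theory Submission
  imports Defs
begin

section \<open>Uniqueness of the Ramanujan remainder\<close>

text \<open>The function \<open>exp (x * z) / x\<close> is the pivot because the derivative of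
  \<open>exp (x * z) * ln x\<close> in x is z times itself plus \<open>exp (x * z) / x\<close>.
  Division by x is integration in z. It turns the elementary remainder
  \<open>exp (x * z) / (1 - exp z) + exp z / z\<close> of \<open>exp (x * z)\<close> into a power
  series; the summand \<open>exp z / z\<close> makes the mean over [1, 2] vanish and at the same
  time cancels the pole at z = 0.

  Two obstacles shape the rest. The formulas for both sums have denominators that vanish at z = 0,
  so z = 0 needs a computation of its own; for other z the simple zero of
  \<open>1 - exp (- z)\<close> is met by a numerator without constant term, and the quotient must
  take the directly computed value at 0. Moreover \<open>ln\<close> and \<open>Digamma\<close> are
  unbounded near 0, so growth is measured on Re x > 1/2. A polynomial factor is carried along, since
  each primitive costs one power; the strict bounds on norm z absorb it in the end.\<close>

lemma exp_growth_bounded_imp_zero: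
  fixes c M d :: real
  assumes "d > 0" "c \<ge> 0" "\<And>y. y \<ge> 0 \<Longrightarrow> c * exp (d * y) \<le> M"
  shows "c = 0"
proof (rule ccontr)
  assume "c \<noteq> 0"
  then have c: "c > 0" using assms by simp
  have M: "M \<ge> 0" using assms(3)[of 0] c by simp
  \<comment> \<open>At this y the linear lower bound \<open>c * (1 + d * y)\<close> equals c + M,
    which exceeds M.\<close>
  define y where "y = M / (c * d)"
  have "y \<ge> 0" using c M assms by (simp add: y_def)
  have "c * (1 + d * y) \<le> c * exp (d * y)"
    using c by (intro mult_left_mono exp_ge_add_one_self) auto
  also have "\<dots> \<le> M" using assms(3) \<open>y \<ge> 0\<close> by simp
  finally have "c + M \<le> M" using c assms by (simp add: y_def algebra_simps)
  with c show False by simp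
qed

lemma norm_sin_le: "norm (sin w) \<le> exp \<bar>Im w\<bar>" for w :: complex
  using cmod_sin_le_exp[of 1 w] by simp

text \<open>The factor 1/4 has two halves: one from the exponential formula for the sine, one from
  exp (- y) being at most half of exp y as soon as y >= 1.\<close>

lemma norm_sin_ge:
  assumes "\<bar>Im w\<bar> \<ge> 1"
  shows "norm (sin w) \<ge> exp \<bar>Im w\<bar> / 4"
proof -
  have "exp \<bar>Im w\<bar> - exp (- \<bar>Im w\<bar>) \<le> \<bar>exp (- Im w) - exp (Im w)\<bar>"
    by (cases "Im w \<ge> 0") auto
  also have "\<dots> \<le> norm (exp (\<i> * w) - exp (- (\<i> * w)))"
    using norm_triangle_ineq3[of "exp (\<i> * w)" "exp (- (\<i> * w))"] by simp
  finally have 1: "exp \<bar>Im w\<bar> - exp (- \<bar>Im w\<bar>) \<le> 2 * norm (sin w)"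
    by (simp add: sin_exp_eq norm_divide norm_mult)
  have "exp (- \<bar>Im w\<bar>) \<le> exp \<bar>Im w\<bar> / 2"
  proof -
    have "2 \<le> exp (2 * \<bar>Im w\<bar>)" using exp_ge_add_one_self[of "2 * \<bar>Im w\<bar>"] assms by linarith
    then have "2 * exp (- \<bar>Im w\<bar>) \<le> exp (2 * \<bar>Im w\<bar>) * exp (- \<bar>Im w\<bar>)" by (intro mult_right_mono) auto
    also have "\<dots> = exp \<bar>Im w\<bar>" by (simp flip: exp_add)
    finally show ?thesis by simp
  qed
  with 1 show ?thesis by linarith
qed

lemma norm_diff3: "norm (a - b - c) \<le> norm a + norm b + norm (c :: 'a :: real_normed_vector)"
  using norm_triangle_ineq4[of "a - b" c] norm_triangle_ineq4[of a b] by linarith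

lemma periodic_int:
  assumes "\<And>x. f (x + 1) = f (x :: complex)"
  shows "f (x + of_int n) = f x"
proof (induction n arbitrary: x rule: int_induct[where k = 0])
  case (step1 i)
  then show ?case using assms[of "x + of_int i"] by (simp add: add.assoc)
next
  case (step2 i)
  have "f (x + of_int (i - 1)) = f (x + of_int (i - 1) + 1)" by (rule assms[symmetric])
  also have "\<dots> = f x" using step2 by (simp add: algebra_simps)
  finally show ?case .
qed simp

text \<open>The zeros of s are simple, hence isolated, and g vanishes at them, so every singularity
  of g / s is removable. The values prescribed there are the l'Hopital limits.\<close>

lemma entire_quotient:
  fixes g s :: "complex \<Rightarrow> complex"
  assumes g: "g holomorphic_on UNIV" and s: "s holomorphic_on UNIV"
    and s': "\<And>x. s x = 0 \<Longrightarrow> deriv s x \<noteq> 0" and g0: "\<And>x. s x = 0 \<Longrightarrow> g x = 0"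
  shows "(\<lambda>x. if s x = 0 then deriv g x / deriv s x else g x / s x) holomorphic_on UNIV" (is "?h holomorphic_on _")
proof -
  have Dg: "(g has_field_derivative deriv g x) (at x)" and Ds: "(s has_field_derivative deriv s x) (at x)" for x
    using g s by (auto intro: holomorphic_derivI)
  have "\<exists>A. open A \<and> x \<in> A \<and> ?h holomorphic_on A" for x
  proof (cases "s x = 0")
    case False
    have "open (s -` (- {0}))"
      by (rule open_vimage) (use s holomorphic_on_imp_continuous_on in auto)
    moreover have "?h holomorphic_on (s -` (- {0}))"
    proof (rule holomorphic_transform)
      show "(\<lambda>x. g x / s x) holomorphic_on (s -` (- {0}))"
        using g s by (intro holomorphic_intros) (auto intro: holomorphic_on_subset)
    qed auto
    ultimately show ?thesis using False by (intro exI[of _ "s -` (- {0})"]) auto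
  next
    case True
    have "\<exists>A. open A \<and> x \<in> A \<and> (\<forall>y\<in>A - {x}. s y \<noteq> 0)"
    proof -
      have "((\<lambda>y. (s y - s x) / (y - x)) \<longlongrightarrow> deriv s x) (at x)"
        using Ds[of x] by (simp add: has_field_derivative_iff)
      then have "\<forall>\<^sub>F y in at x. (s y - s x) / (y - x) \<noteq> 0"
        using s'[OF True] by (rule tendsto_imp_eventually_ne)
      then obtain A where A: "open A" "x \<in> A" "\<And>y. y \<in> A \<Longrightarrow> y \<noteq> x \<Longrightarrow> (s y - s x) / (y - x) \<noteq> 0"
        unfolding eventually_at_topological by blast
      then show ?thesis using True by (intro exI[of _ A]) auto
    qed
    then obtain A where A: "open A" "x \<in> A" "\<And>y. y \<in> A - {x} \<Longrightarrow> s y \<noteq> 0" by blast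
    have "?h holomorphic_on A"
    proof (rule no_isolated_singularity'[where K = "{x}"])
      show "?h holomorphic_on A - {x}"
      proof (rule holomorphic_transform)
        show "(\<lambda>x. g x / s x) holomorphic_on A - {x}"
          using g s A by (intro holomorphic_intros) (auto intro: holomorphic_on_subset)
      qed (use A in auto)
      fix z assume "z \<in> {x}"
      then have z: "z = x" by simp
      have "((\<lambda>y. g y / s y) \<longlongrightarrow> deriv g x / deriv s x) (at x)"
        using Dg Ds g0[OF True] True s'[OF True] by (intro lhopital_complex_simple) auto
      moreover have "\<forall>\<^sub>F y in at x. g y / s y = ?h y"
        unfolding eventually_at_topological using A by (intro exI[of _ A]) auto
      ultimately have "(?h \<longlongrightarrow> deriv g x / deriv s x) (at x)"
        by (rule Lim_transform_eventually)
      then show "(?h \<longlongrightarrow> ?h z) (at z within A)"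
        using True z by (auto intro: tendsto_within_subset)
    qed (use A in auto)
    with A show ?thesis by blast
  qed
  then obtain A where A: "\<And>x. open (A x)" "\<And>x. x \<in> A x" "\<And>x. ?h holomorphic_on A x" by metis
  have "?h holomorphic_on (\<Union>x\<in>UNIV. A x)"
    by (rule holomorphic_on_UN_open) (use A in auto)
  also have "(\<Union>x\<in>UNIV. A x) = UNIV" using A(2) by auto
  finally show ?thesis .
qed

text \<open>
  Subtracting a combination of \<open>1\<close> and \<open>sin\<^sup>2 (\<pi> x)\<close> makes the function vanish at all
  half-integers. Its quotient by \<open>sin (2 \<pi> x)\<close> is then entire, and bounded because
  \<open>\<beta> < 2 \<pi>\<close>. So the function is a trigonometric polynomial of degree at most \<open>1\<close>, and
  the growth condition leaves only the constant term.
\<close>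

lemma periodic_entire_const:
  fixes f :: "complex \<Rightarrow> complex"
  assumes hol: "f holomorphic_on UNIV" and per: "\<And>x. f (x + 1) = f x"
    and bound: "\<And>x. Re x \<in> {1..2} \<Longrightarrow> norm (f x) \<le> K * exp (\<beta> * \<bar>Im x\<bar>)"
    and \<beta>: "0 \<le> \<beta>" "\<beta> < 2 * pi"
  shows "f x = f 1"
proof -
  \<comment> \<open>The square of sin (pi x) is 0 at 1 and 1 at 1/2, so this b makes g vanish at
    both points, and by periodicity at every zero of s.\<close>
  define b where "b = f (1/2) - f 1"
  define g where "g x = f x - f 1 - b * sin (of_real pi * x) ^ 2" for x
  define s where "s x = sin (of_real (2 * pi) * x)" for x :: complex
  define h where "h x = (if s x = 0 then deriv g x / deriv s x else g x / s x)" for x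
  have s': "(s has_field_derivative (cos (of_real (2 * pi) * x) * of_real (2 * pi))) (at x)" for x
    unfolding s_def by (auto intro!: derivative_eq_intros)
  have gper: "g (x + 1) = g x" for x
    by (simp add: g_def per ring_distribs sin_add)
  have sper: "s (x + 1) = s x" for x
    by (simp add: s_def ring_distribs sin_add sin_of_real cos_of_real flip: of_real_mult)
  have dshift: "deriv u (x + 1) = deriv u x" if "\<And>x. u (x + 1) = u x" for u :: "complex \<Rightarrow> complex" and x
    using DERIV_shift[of u _ x 1] that by (simp add: deriv_def)
  have hper: "h (x + 1) = h x" for x
    by (simp add: h_def gper sper dshift)
  have g0: "g x = 0" if "s x = 0" for x
  proof -
    have "\<exists>n::int. of_real (2 * pi) * x = of_real (of_int n * pi)"
      using that unfolding s_def sin_eq_0 by simp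
    then obtain n :: int where n: "of_real (2 * pi) * x = of_real (of_int n * pi)" by blast
    then have x: "x = of_int n / 2" by (simp add: field_simps)
    have g1: "g 1 = 0" "g (1/2) = 0"
      by (simp_all add: g_def b_def sin_of_real[symmetric] flip: of_real_divide)
    show ?thesis
    proof (cases "even n")
      case True
      then obtain k where "n = 2 * k" by blast
      then have "x = 1 + of_int (k - 1)" using x by simp
      then show ?thesis using periodic_int[of g 1 "k - 1"] gper g1 by metis
    next
      case False
      then obtain k where "n = 2 * k + 1" by (auto elim: oddE)
      then have "x = 1/2 + of_int k" using x by (simp add: field_simps)
      then show ?thesis using periodic_int[of g "1/2" k] gper g1 by metis
    qed
  qed
  have "h holomorphic_on UNIV" unfolding h_def
  proof (rule entire_quotient)
    show "g holomorphic_on UNIV" unfolding g_def by (intro holomorphic_intros hol)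
    show "s holomorphic_on UNIV" unfolding s_def by (intro holomorphic_intros)
    show "deriv s x \<noteq> 0" if "s x = 0" for x
      using that DERIV_imp_deriv[OF s', of x] sin_cos_squared_add[of "of_real (2 * pi) * x"]
      by (auto simp: s_def)
  qed (rule g0)
  \<comment> \<open>Periodicity reduces the bound to the strip 1 <= Re x <= 2. Near the real axis
    compactness suffices; away from it numerator and denominator are both compared with
    \<open>exp (2 * pi * \<bar>Im x\<bar>)\<close>.\<close>
  moreover have "bounded (range h)"
  proof -
    have ch: "continuous_on A h" for A
      using holomorphic_on_imp_continuous_on[OF \<open>h holomorphic_on UNIV\<close>] continuous_on_subset by blast
    have "compact (h ` cbox (Complex 1 (-1)) (Complex 2 1))"
      by (intro compact_continuous_image ch compact_cbox)
    then obtain B1 where B1: "\<And>x. x \<in> cbox (Complex 1 (-1)) (Complex 2 1) \<Longrightarrow> norm (h x) \<le> B1"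
      using compact_imp_bounded bounded_iff by (metis imageI)
    define B2 where "B2 = 4 * (\<bar>K\<bar> + norm (f 1) + norm b)"
    have B2: "norm (h x) \<le> B2" if "Re x \<in> {1..2}" "\<bar>Im x\<bar> \<ge> 1" for x
    proof -
      define E where "E = exp (2 * pi * \<bar>Im x\<bar>)"
      have E: "E \<ge> 1" unfolding E_def by simp
      have im: "\<bar>Im (of_real (2 * pi) * x)\<bar> = 2 * pi * \<bar>Im x\<bar>" "\<bar>Im (of_real pi * x)\<bar> = pi * \<bar>Im x\<bar>"
        by (simp_all add: abs_mult)
      have "2 * pi * \<bar>Im x\<bar> \<ge> 1 * 1" using that pi_gt3 by (intro mult_mono) auto
      then have sx: "norm (s x) \<ge> E / 4"
        using norm_sin_ge[of "of_real (2 * pi) * x"] im by (simp add: s_def E_def)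
      then have "s x \<noteq> 0" using E by auto
      have sq: "norm (sin (of_real pi * x)) ^ 2 \<le> E"
      proof -
        have "norm (sin (of_real pi * x)) ^ 2 \<le> exp (pi * \<bar>Im x\<bar>) ^ 2"
          using norm_sin_le[of "of_real pi * x"] im by (intro power_mono) auto
        then show ?thesis by (simp add: E_def mult.assoc flip: exp_double)
      qed
      have fx: "norm (f x) \<le> \<bar>K\<bar> * E"
      proof -
        have "norm (f x) \<le> K * exp (\<beta> * \<bar>Im x\<bar>)" using bound that by simp
        also have "\<dots> \<le> \<bar>K\<bar> * E" unfolding E_def
          using \<beta> by (intro mult_mono) (auto intro!: mult_right_mono)
        finally show ?thesis .
      qed
      have "norm (g x) \<le> norm (f x) + norm (f 1) + norm b * norm (sin (of_real pi * x)) ^ 2"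
        unfolding g_def using norm_triangle_ineq4[of "f x - f 1" "b * sin (of_real pi * x) ^ 2"] norm_triangle_ineq4[of "f x" "f 1"]
        by (simp add: norm_mult norm_power)
      also have "\<dots> \<le> \<bar>K\<bar> * E + norm (f 1) * E + norm b * E"
        using fx sq E by (intro add_mono mult_left_mono) (auto simp: mult_le_cancel_left1)
      also have "\<dots> = B2 * (E / 4)" by (simp add: B2_def algebra_simps)
      also have "\<dots> \<le> B2 * norm (s x)" using sx by (intro mult_left_mono) (auto simp: B2_def)
      finally show ?thesis using \<open>s x \<noteq> 0\<close> by (simp add: h_def norm_divide divide_le_eq)
    qed
    have "norm (h x) \<le> max B1 B2" for x
    proof -
      define x' where "x' = x + of_int (1 - \<lfloor>Re x\<rfloor>)"
      have "h x = h x'" unfolding x'_def using periodic_int[of h x] hper by metis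
      have re: "Re x' \<in> {1..2}" unfolding x'_def by (simp add: algebra_simps) linarith
      show ?thesis
      proof (cases "\<bar>Im x'\<bar> \<ge> 1")
        case False
        then have "x' \<in> cbox (Complex 1 (-1)) (Complex 2 1)"
          using re by (auto simp: in_cbox_complex_iff)
        then show ?thesis using B1[of x'] \<open>h x = h x'\<close> by simp
      qed (use B2[of x'] re \<open>h x = h x'\<close> in simp)
    qed
    then show ?thesis unfolding bounded_iff by blast
  qed
  ultimately have "h constant_on UNIV" by (rule Liouville_theorem)
  then obtain k where "\<And>x. h x = k" unfolding constant_on_def by auto
  then have gk: "g x = k * s x" for x
    using g0[of x] h_def[of x] by (cases "s x = 0") auto
  \<comment> \<open>These are the Fourier coefficients at the frequencies 1 and -1, collected from b
    times the squared sine and from k times s.\<close>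
  define B C where "B = - b / 4 - \<i> * k / 2" and "C = - b / 4 + \<i> * k / 2"
  have f_eq: "f x = (f 1 + b / 2) + B * exp (\<i> * (2 * of_real pi * x)) + C * exp (- (\<i> * (2 * of_real pi * x)))" for x
  proof -
    have "f x = f 1 + b * sin (of_real pi * x) ^ 2 + k * s x"
      using gk[of x] by (simp add: g_def algebra_simps)
    moreover have "sin (of_real pi * x) ^ 2 = 1 / 2 - (exp (\<i> * (2 * of_real pi * x)) + exp (- (\<i> * (2 * of_real pi * x)))) / 4"
    proof -
      have "sin (of_real pi * x) ^ 2 = (1 - cos (2 * of_real pi * x)) / 2"
        using cos_double_sin[of "of_real pi * x"] by (simp add: mult.assoc)
      then show ?thesis by (simp add: cos_exp_eq field_simps)
    qed
    moreover have "s x = - \<i> / 2 * (exp (\<i> * (2 * of_real pi * x)) - exp (- (\<i> * (2 * of_real pi * x))))"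
      by (simp add: s_def sin_exp_eq' field_simps)
    moreover have "f 1 + b * (1 / 2 - (p + q) / 4) + k * (- \<i> / 2 * (p - q)) = (f 1 + b / 2) + B * p + C * q" for p q
      unfolding B_def C_def by (simp add: algebra_simps add_divide_distrib diff_divide_distrib)
    ultimately show ?thesis by (simp only:)
  qed
  have e1: "exp (\<i> * (2 * of_real pi * (1 + \<i> * of_real y))) = of_real (exp (- (2 * pi * y)))" for y
  proof -
    have "\<i> * (2 * of_real pi * (1 + \<i> * of_real y)) = 2 * of_real pi * \<i> + of_real (- (2 * pi * y))"
      by (simp add: algebra_simps)
    then show ?thesis by (simp only: exp_add exp_two_pi_i exp_of_real mult_1)
  qed
  have e2: "exp (- (\<i> * (2 * of_real pi * (1 + \<i> * of_real y)))) = of_real (exp (2 * pi * y))" for y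
    unfolding exp_minus[of "\<i> * _"] e1 by (simp add: exp_minus)
  have fy: "f (1 + \<i> * of_real y) = (f 1 + b / 2) + B * of_real (exp (- (2 * pi * y))) + C * of_real (exp (2 * pi * y))" for y
    unfolding f_eq[of "1 + \<i> * of_real y"] e1 e2 ..
  define M where "M = \<bar>K\<bar> + norm (f 1 + b / 2) + norm B + norm C"
  have grow: "norm W * exp ((2 * pi - \<beta>) * y) \<le> M"
    if y: "y \<ge> 0" and W: "norm W * exp (2 * pi * y) \<le> norm F + norm (f 1 + b / 2) + norm V * exp (- (2 * pi * y))"
      and F: "norm F \<le> K * exp (\<beta> * y)" and VM: "norm V \<le> norm B + norm C" for W V F :: complex and y
  proof -
    have "norm W * exp (2 * pi * y) \<le> K * exp (\<beta> * y) + norm (f 1 + b / 2) * exp (\<beta> * y) + norm V * exp (\<beta> * y)"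
    proof (rule order_trans[OF W], intro add_mono F)
      show "norm (f 1 + b / 2) \<le> norm (f 1 + b / 2) * exp (\<beta> * y)"
        using y \<beta> by (simp add: mult_le_cancel_left1)
      show "norm V * exp (- (2 * pi * y)) \<le> norm V * exp (\<beta> * y)"
      proof (intro mult_left_mono)
        have "0 \<le> 2 * pi * y" "0 \<le> \<beta> * y" using y \<beta> by auto
        then have "- (2 * pi * y) \<le> \<beta> * y" by linarith
        then show "exp (- (2 * pi * y)) \<le> exp (\<beta> * y)" by simp
      qed simp
    qed
    also have "\<dots> \<le> M * exp (\<beta> * y)"
      using VM by (simp add: M_def flip: distrib_right)
    finally have "norm W * exp (2 * pi * y) * exp (- (\<beta> * y)) \<le> M * exp (\<beta> * y) * exp (- (\<beta> * y))"
      by (intro mult_right_mono) auto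
    then show ?thesis by (simp add: mult.assoc algebra_simps flip: exp_add)
  qed
  \<comment> \<open>At 1 + iy with y to +infinity the C term grows like exp (2 pi y), but f only
    like exp (\<beta> y). The same argument in the direction of -i removes B.\<close>
  have "norm C = 0"
  proof (rule exp_growth_bounded_imp_zero[of "2 * pi - \<beta>"])
    fix y :: real assume y: "y \<ge> 0"
    have "C * of_real (exp (2 * pi * y)) = f (1 + \<i> * of_real y) - (f 1 + b / 2) - B * of_real (exp (- (2 * pi * y)))"
      unfolding fy by simp
    then have "norm (C * of_real (exp (2 * pi * y))) \<le> norm (f (1 + \<i> * of_real y)) + norm (f 1 + b / 2) + norm (B * of_real (exp (- (2 * pi * y))))"
      by (simp only: norm_diff3)
    then have "norm C * exp (2 * pi * y) \<le> norm (f (1 + \<i> * of_real y)) + norm (f 1 + b / 2) + norm B * exp (- (2 * pi * y))"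
      by (simp add: norm_mult)
    moreover have "norm (f (1 + \<i> * of_real y)) \<le> K * exp (\<beta> * y)"
      using bound[of "1 + \<i> * of_real y"] y by simp
    ultimately show "norm C * exp ((2 * pi - \<beta>) * y) \<le> M" by (intro grow[OF y]) auto
  qed (use \<beta> in auto)
  moreover have "norm B = 0"
  proof (rule exp_growth_bounded_imp_zero[of "2 * pi - \<beta>"])
    fix y :: real assume y: "y \<ge> 0"
    have "B * of_real (exp (2 * pi * y)) = f (1 + \<i> * of_real (- y)) - (f 1 + b / 2) - C * of_real (exp (- (2 * pi * y)))"
      unfolding fy by simp
    then have "norm (B * of_real (exp (2 * pi * y))) \<le> norm (f (1 + \<i> * of_real (- y))) + norm (f 1 + b / 2) + norm (C * of_real (exp (- (2 * pi * y))))"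
      by (simp only: norm_diff3)
    then have "norm B * exp (2 * pi * y) \<le> norm (f (1 + \<i> * of_real (- y))) + norm (f 1 + b / 2) + norm C * exp (- (2 * pi * y))"
      by (simp add: norm_mult)
    moreover have "norm (f (1 + \<i> * of_real (- y))) \<le> K * exp (\<beta> * y)"
      using bound[of "1 + \<i> * of_real (- y)"] y by simp
    ultimately show "norm B * exp ((2 * pi - \<beta>) * y) \<le> M" by (intro grow[OF y]) auto
  qed (use \<beta> in auto)
  ultimately have "f x = f 1 + b / 2" for x using f_eq[of x] by simp
  then show ?thesis by metis
qed

text \<open>By periodicity any integer shift that brings x into the half-plane gives the same value
  (\<open>F_eq\<close>). On Re x > -n the single shift n works throughout, which gives holomorphy on
  half-planes exhausting the plane.\<close>

lemma periodic_half_plane_extension: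
  fixes f :: "complex \<Rightarrow> complex"
  assumes hol: "f holomorphic_on right_half_plane"
    and per: "\<And>x. x \<in> right_half_plane \<Longrightarrow> f (x + 1) = f x"
  obtains F where "F holomorphic_on UNIV" "\<And>x. F (x + 1) = F x" "\<And>x. x \<in> right_half_plane \<Longrightarrow> F x = f x"
proof
  define F where "F x = f (x + of_nat (nat \<lceil>1 - Re x\<rceil>))" for x
  have per_nat: "f (x + of_nat n) = f x" if "x \<in> right_half_plane" for x n
  proof (induction n)
    case (Suc n)
    have "f (x + of_nat n + 1) = f (x + of_nat n)"
      using that by (intro per) (simp add: right_half_plane_def)
    then show ?case using Suc by (simp add: add_ac)
  qed simp
  have F_eq: "F x = f (x + of_nat n)" if "Re x + of_nat n > 0" for x n
  proof -
    define N where "N = nat \<lceil>1 - Re x\<rceil>"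
    have "Re x + of_nat N > 0" unfolding N_def by linarith
    then have "f (x + of_nat N + of_nat n) = f (x + of_nat N)" "f (x + of_nat n + of_nat N) = f (x + of_nat n)"
      using that by (auto intro!: per_nat simp: right_half_plane_def)
    then show ?thesis by (simp add: F_def N_def add_ac)
  qed
  show "F x = f x" if "x \<in> right_half_plane" for x
    using F_eq[of x 0] that by (simp add: right_half_plane_def)
  show "F (x + 1) = F x" for x
  proof -
    define n where "n = nat \<lceil>1 - Re x\<rceil>"
    have "Re x + of_nat n > 0" unfolding n_def by linarith
    then show ?thesis using F_eq[of x "Suc n"] F_eq[of "x + 1" n] by (simp add: add_ac)
  qed
  have "F holomorphic_on (\<Union>n. {x. Re x > - of_nat n})"
  proof (rule holomorphic_on_UN_open)
    fix n :: nat
    have "(f \<circ> (\<lambda>x. x + of_nat n)) holomorphic_on {x. Re x > - of_nat n}"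
      by (rule holomorphic_on_compose_gen[OF _ hol]) (auto intro!: holomorphic_intros simp: right_half_plane_def)
    then show "F holomorphic_on {x. Re x > - of_nat n}"
      by (rule holomorphic_transform) (simp add: F_eq[of _ n])
    show "open {x. Re x > - of_nat n}" by (rule open_halfspace_Re_gt)
  qed
  moreover have "(\<Union>n. {x. Re x > - real n}) = UNIV"
  proof (intro equalityI subsetI)
    fix x :: complex
    obtain n where "- Re x < real n" using reals_Archimedean2 by blast
    then show "x \<in> (\<Union>n. {x. Re x > - real n})" by (auto intro!: exI[of _ n])
  qed simp
  ultimately show "F holomorphic_on UNIV" by simp
qed

text \<open>Because c < 1, the bound covers Re x >= 1 and so the closed strip on which uniqueness is
  tested. Passing to \<open>max \<alpha> 0\<close> makes the bound monotone in norm x.\<close>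

lemma exp_type_lessE:
  assumes "exp_type_less \<rho> f" "0 < \<rho>"
  obtains \<beta> K where "0 \<le> \<beta>" "\<beta> < \<rho>" "0 < K" "\<And>x. 1 \<le> Re x \<Longrightarrow> norm (f x) \<le> K * exp (\<beta> * norm x)"
proof -
  obtain c \<alpha> K where *: "0 \<le> c" "c < 1" "\<alpha> < \<rho>" "0 < K" "\<And>x. c < Re x \<Longrightarrow> norm (f x) \<le> K * exp (\<alpha> * norm x)"
    using assms unfolding exp_type_less_def by blast
  have "norm (f x) \<le> K * exp (max \<alpha> 0 * norm x)" if "1 \<le> Re x" for x
  proof -
    have "K * exp (\<alpha> * norm x) \<le> K * exp (max \<alpha> 0 * norm x)"
      using * by (intro mult_left_mono) (auto intro!: mult_right_mono)
    then show ?thesis using *(5)[of x] * that by linarith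
  qed
  then show thesis using * assms by (intro that[of "max \<alpha> 0" K]) auto
qed

text \<open>The difference of two remainders has period 1, hence extends to an entire function. In a
  period strip its growth rate stays below 2 pi, so it is constant, and the vanishing mean over
  [1, 2] makes the constant 0.\<close>

lemma ramanujan_remainder_unique:
  assumes R1: "ramanujan_remainder a R1" and R2: "ramanujan_remainder a R2"
  shows "R1 1 = R2 1"
proof -
  define f where "f x = R1 x - R2 x" for x
  have hol: "f holomorphic_on right_half_plane"
    unfolding f_def using R1 R2 by (intro holomorphic_intros) (auto simp: ramanujan_remainder_def)
  have per: "f (x + 1) = f x" if "x \<in> right_half_plane" for x
  proof -
    have "R1 x - R1 (x + 1) = R2 x - R2 (x + 1)"
      using R1 R2 that by (simp add: ramanujan_remainder_def)
    then show ?thesis by (simp add: f_def algebra_simps)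
  qed
  obtain F where F: "F holomorphic_on UNIV" "\<And>x. F (x + 1) = F x" "\<And>x. x \<in> right_half_plane \<Longrightarrow> F x = f x"
    using periodic_half_plane_extension[OF hol per] by blast
  obtain \<beta>1 K1 where 1: "0 \<le> \<beta>1" "\<beta>1 < 2 * pi" "0 < K1" "\<And>x. 1 \<le> Re x \<Longrightarrow> norm (R1 x) \<le> K1 * exp (\<beta>1 * norm x)"
    using R1 by (auto simp: ramanujan_remainder_def elim: exp_type_lessE)
  obtain \<beta>2 K2 where 2: "0 \<le> \<beta>2" "\<beta>2 < 2 * pi" "0 < K2" "\<And>x. 1 \<le> Re x \<Longrightarrow> norm (R2 x) \<le> K2 * exp (\<beta>2 * norm x)"
    using R2 by (auto simp: ramanujan_remainder_def elim: exp_type_lessE)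
  define \<beta> where "\<beta> = max \<beta>1 \<beta>2"
  have b: "norm (F x) \<le> ((K1 + K2) * exp (2 * \<beta>)) * exp (\<beta> * \<bar>Im x\<bar>)" if "Re x \<in> {1..2}" for x
  proof -
    have "norm (F x) \<le> norm (R1 x) + norm (R2 x)"
      using that F(3)[of x] by (simp add: f_def right_half_plane_def norm_triangle_ineq4)
    also have "\<dots> \<le> K1 * exp (\<beta>1 * norm x) + K2 * exp (\<beta>2 * norm x)"
      using that 1(4)[of x] 2(4)[of x] by simp
    also have "\<dots> \<le> K1 * exp (\<beta> * norm x) + K2 * exp (\<beta> * norm x)"
      using 1 2 by (intro add_mono mult_left_mono) (auto simp: \<beta>_def intro!: mult_right_mono)
    also have "\<dots> = (K1 + K2) * exp (\<beta> * norm x)" by (simp add: algebra_simps)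
    also have "\<dots> \<le> (K1 + K2) * exp (\<beta> * (2 + \<bar>Im x\<bar>))"
    proof -
      have "norm x \<le> 2 + \<bar>Im x\<bar>" using cmod_le[of x] that by auto
      moreover have "\<beta> \<ge> 0" using 1 by (simp add: \<beta>_def)
      ultimately show ?thesis using 1 2 by (intro mult_left_mono exp_le_cancel_iff[THEN iffD2]) auto
    qed
    finally show ?thesis by (simp add: exp_add algebra_simps)
  qed
  have const: "F x = F 1" for x
    by (rule periodic_entire_const[OF F(1,2) b]) (use 1 2 in \<open>auto simp: \<beta>_def\<close>)
  have "((\<lambda>t::real. R1 (of_real t) - R2 (of_real t)) has_integral (0 - 0)) {1..2}"
    using R1 R2 by (intro has_integral_diff) (auto simp: ramanujan_remainder_def)
  moreover have "R1 (of_real t) - R2 (of_real t) = F 1" if "t \<in> {1..2}" for t :: real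
    using F(3)[of "of_real t"] const[of "of_real t"] that by (simp add: f_def right_half_plane_def)
  ultimately have "((\<lambda>t::real. F 1) has_integral 0) {1..2}"
    using has_integral_eq[of "{1..2}" "\<lambda>t. R1 (of_real t) - R2 (of_real t)" "\<lambda>_. F 1" 0] by simp
  moreover have "((\<lambda>t::real. F 1) has_integral F 1) {1..2}"
    using has_integral_const_real[of "F 1" 1 2] by simp
  ultimately have "F 1 = 0" using has_integral_unique by blast
  then show ?thesis using F(3)[of 1] by (simp add: f_def right_half_plane_def)
qed

lemma ramanujan_sum_eqI:
  assumes "ramanujan_admissible a" "ramanujan_remainder a R"
  shows "ramanujan_sum a = R 1"
  unfolding ramanujan_sum_def using assms ramanujan_remainder_unique by blast

section \<open>The power series of the remainder of exp (x * z) / x\<close>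

text \<open>The series of (exp u - 1) / u: the shift discards the constant term and divides by u.
  Unlike 1 - exp u it has an invertible constant term.\<close>

definition expm1_quot_fps :: "complex fps" where
  "expm1_quot_fps = fps_shift 1 (fps_exp 1)"

definition bernF :: "complex fps" where
  "bernF = - inverse expm1_quot_fps"

definition bern_fun :: "complex \<Rightarrow> complex" where
  "bern_fun u = (if u = 0 then -1 else u / (1 - exp u))"

lemma expm1_quot_fps_nth: "fps_nth expm1_quot_fps n = 1 / fact (Suc n)"
  by (simp add: expm1_quot_fps_def algebra_simps)

lemma bernF_mult: "bernF * (1 - fps_exp 1) = fps_X"
proof -
  have "fps_nth expm1_quot_fps 0 \<noteq> 0" by (simp add: expm1_quot_fps_nth)
  then have inv: "inverse expm1_quot_fps * expm1_quot_fps = 1" by (rule inverse_mult_eq_1)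
  have "1 - fps_exp 1 = - (fps_X * expm1_quot_fps)"
    by (rule fps_ext) (auto simp: expm1_quot_fps_nth simp del: fact_Suc)
  then have "bernF * (1 - fps_exp 1) = (inverse expm1_quot_fps * expm1_quot_fps) * fps_X"
    by (simp add: bernF_def mult_ac)
  then show ?thesis by (simp add: inv)
qed

lemma bernF_nth_0: "fps_nth bernF 0 = -1"
  by (simp add: bernF_def expm1_quot_fps_nth)

lemma bernF_nth_1: "fps_nth bernF 1 = 1 / 2"
proof -
  have "fps_nth (bernF * (1 - fps_exp 1)) 2 = 0" by (simp add: bernF_mult)
  then show ?thesis
    by (simp add: fps_mult_nth numeral_2_eq_2 bernF_nth_0 field_simps)
qed

lemma fact_in_Rats [simp]: "(fact n :: 'a :: field_char_0) \<in> \<rat>"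
  by (metis Rats_of_nat of_nat_fact)

text \<open>The product with \<open>expm1_quot_fps\<close> is -1, and that series has rational
  coefficients and constant term 1. So each coefficient is a rational expression in the earlier
  ones.\<close>

lemma bernF_nth_rat: "fps_nth bernF n \<in> \<rat>"
proof (induction n rule: less_induct)
  case (less n)
  have "fps_nth (bernF * expm1_quot_fps) n = fps_nth (-1 :: complex fps) n"
    using inverse_mult_eq_1[of expm1_quot_fps] by (simp add: bernF_def expm1_quot_fps_nth)
  then have "fps_nth bernF n + (\<Sum>i<n. fps_nth bernF i * fps_nth expm1_quot_fps (n - i)) = (if n = 0 then -1 else 0)"
    by (cases n) (auto simp: fps_mult_nth atLeast0AtMost lessThan_Suc_atMost[symmetric] expm1_quot_fps_nth add.commute add.left_commute simp del: fact_Suc)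
  then have "fps_nth bernF n = (if n = 0 then -1 else 0) - (\<Sum>i<n. fps_nth bernF i * fps_nth expm1_quot_fps (n - i))"
    by (simp add: algebra_simps)
  also have "\<dots> \<in> \<rat>"
    using less by (intro Rats_diff Rats_sum Rats_mult) (auto simp: expm1_quot_fps_nth fact_in_Rats simp del: fact_Suc)
  finally show ?case .
qed

section \<open>Convergence of the Bernoulli generating series for norm u < 2 pi\<close>

lemma exp_ne_1:
  fixes u :: complex assumes "norm u < 2 * pi" "u \<noteq> 0" shows "exp u \<noteq> 1"
proof
  assume "exp u = 1"
  then obtain n :: int where n: "Re u = 0" "Im u = of_int (2 * n) * pi"
    by (auto simp: exp_eq_1)
  have "\<bar>Im u\<bar> < 2 * pi" using assms abs_Im_le_cmod[of u] by linarith
  then have "\<bar>real_of_int n\<bar> < 1" using n by (simp add: abs_mult)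
  then have "n = 0" by linarith
  with n assms show False by (simp add: complex_eq_iff)
qed

lemma eval_expm1_quot: "u * eval_fps expm1_quot_fps u = exp u - 1"
proof -
  have "eval_fps (fps_X * expm1_quot_fps) u = eval_fps (fps_exp 1 - 1) u"
    by (rule arg_cong[where f = "\<lambda>F. eval_fps F u"], rule fps_ext)
       (auto simp: expm1_quot_fps_nth simp del: fact_Suc)
  moreover have "fps_conv_radius expm1_quot_fps = \<infinity>"
    by (simp add: expm1_quot_fps_def)
  ultimately show ?thesis by (simp add: eval_fps_mult eval_fps_diff)
qed

text \<open>On the disc \<open>bern_fun\<close> is minus the reciprocal of the entire function (exp
  u - 1) / u. That function is 1 at 0 and otherwise vanishes only where exp u = 1, so it has no zero
  in the disc and the expansion converges on all of it.\<close>

lemma bern_fun_sums: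
  assumes "norm u < 2 * pi"
  shows "(\<lambda>n. fps_nth bernF n * u ^ n) sums bern_fun u"
proof -
  let ?M = "eval_fps expm1_quot_fps"
  have rad: "fps_conv_radius expm1_quot_fps = \<infinity>"
    by (simp add: expm1_quot_fps_def)
  have M0: "?M 0 = 1" by (simp add: eval_fps_at_0 expm1_quot_fps_nth)
  have eq: "bern_fun w = - inverse (?M w)" if "norm w < 2 * pi" for w
    using eval_expm1_quot[of w] exp_ne_1[OF that] M0
  proof (cases "w = 0")
    case False
    then have "?M w = (exp w - 1) / w"
      using eval_expm1_quot[of w] by (simp add: field_simps)
    then have "- inverse (?M w) = - (w / (exp w - 1))" by simp
    also have "\<dots> = w / (1 - exp w)" by (metis minus_diff_eq minus_divide_right)
    finally show ?thesis using False by (simp add: bern_fun_def)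
  qed (simp add: bern_fun_def M0)
  have nz: "?M w \<noteq> 0" if "norm w < 2 * pi" for w
    using eval_expm1_quot[of w] exp_ne_1[OF that] M0 by (cases "w = 0") auto
  have "?M has_fps_expansion expm1_quot_fps"
    by (rule eval_fps_has_fps_expansion) (simp add: rad)
  then have "(\<lambda>w. - inverse (?M w)) has_fps_expansion bernF"
    unfolding bernF_def
    by (intro has_fps_expansion_minus has_fps_expansion_inverse) (simp_all add: expm1_quot_fps_nth)
  then have "(\<lambda>n. fps_nth bernF n * u ^ n) sums (- inverse (?M u))"
  proof (rule has_fps_expansion_imp_sums_complex)
    show "(\<lambda>w. - inverse (?M w)) holomorphic_on eball 0 (ereal (2 * pi))"
      using nz by (intro holomorphic_intros) (auto simp: rad)
  qed (use assms in auto)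
  then show ?thesis by (simp add: eq assms)
qed

lemma bern_norm_summable:
  assumes "0 \<le> r" "r < 2 * pi"
  shows "summable (\<lambda>n. norm (fps_nth bernF n) * r ^ n)"
proof -
  obtain s where s: "r < s" "s < 2 * pi" using dense assms(2) by blast
  have "summable (\<lambda>n. fps_nth bernF n * of_real s ^ n)"
    using bern_fun_sums[of "of_real s"] s assms by (auto simp: sums_iff)
  from powser_insidea[OF this, of "of_real r"] show ?thesis
    using s assms by (simp add: norm_mult norm_power)
qed

text \<open>
  \<open>bern_poly n x\<close> is \<open>- B\<^sub>n(x) / n!\<close> for the Bernoulli polynomial \<open>B\<^sub>n\<close>, since
  \<open>bernF\<close> expands \<open>u / (1 - exp u)\<close>.
\<close>

definition bern_poly :: "nat \<Rightarrow> complex \<Rightarrow> complex" where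
  "bern_poly n x = (\<Sum>i\<le>n. fps_nth bernF i * (x ^ (n - i) / fact (n - i)))"

lemma bern_poly_eq_fps: "bern_poly n x = fps_nth (bernF * fps_exp x) n"
  by (simp add: bern_poly_def fps_mult_nth atLeast0AtMost)

text \<open>Compare coefficients after multiplying \<open>bernF * (1 - fps_exp 1) = fps_X\<close> by
  \<open>fps_exp x\<close>; the factor \<open>fps_X\<close> causes the shift of the index.\<close>

lemma bern_poly_diff:
  "bern_poly (Suc n) x - bern_poly (Suc n) (x + 1) = x ^ n / fact n"
proof -
  have "bern_poly (Suc n) x - bern_poly (Suc n) (x + 1) = fps_nth (bernF * (1 - fps_exp 1) * fps_exp x) (Suc n)"
    by (simp add: bern_poly_eq_fps fps_exp_add_mult algebra_simps)
  then show ?thesis unfolding bernF_mult by simp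
qed

lemma bern_poly_has_field_derivative:
  "(bern_poly (Suc n) has_field_derivative bern_poly n x) (at x)"
proof -
  have *: "((\<lambda>x. x ^ Suc k / fact (Suc k)) has_field_derivative x ^ k / fact k) (at x)" for k and x::complex
  proof -
    have "((\<lambda>x. x ^ Suc k / fact (Suc k)) has_field_derivative (of_nat (Suc k) * x ^ k) / fact (Suc k)) (at x)"
      using DERIV_power[OF DERIV_ident, of "Suc k" x UNIV]
      by (intro DERIV_cdivide) (simp del: power_Suc fact_Suc of_nat_Suc)
    then show ?thesis by (simp add: field_simps del: of_nat_Suc power_Suc)
  qed
  have "bern_poly (Suc n) = (\<lambda>x. (\<Sum>i\<le>n. fps_nth bernF i * (x ^ (Suc (n - i)) / fact (Suc (n - i)))) + fps_nth bernF (Suc n))"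
    by (auto simp: bern_poly_def fun_eq_iff Suc_diff_le)
  moreover have "((\<lambda>x. (\<Sum>i\<le>n. fps_nth bernF i * (x ^ (Suc (n - i)) / fact (Suc (n - i)))) + fps_nth bernF (Suc n))
      has_field_derivative bern_poly n x + 0) (at x)"
    unfolding bern_poly_def[of n] by (intro DERIV_add DERIV_sum DERIV_cmult * DERIV_const)
  ultimately show ?thesis by (simp only: add_0_right)
qed

lemma bern_poly_bound:
  assumes "norm x \<le> R" "0 \<le> r"
  shows "norm (bern_poly n x) * r ^ n \<le>
    (\<Sum>i\<le>n. (norm (fps_nth bernF i) * r ^ i) * ((R * r) ^ (n - i) / fact (n - i)))"
proof -
  have "norm (bern_poly n x) * r ^ n \<le> (\<Sum>i\<le>n. norm (fps_nth bernF i * (x ^ (n - i) / fact (n - i)))) * r ^ n"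
    unfolding bern_poly_def by (intro mult_right_mono norm_sum) (use assms in auto)
  also have "\<dots> \<le> (\<Sum>i\<le>n. (norm (fps_nth bernF i) * r ^ i) * ((R * r) ^ (n - i) / fact (n - i)))"
    unfolding sum_distrib_right
  proof (rule sum_mono)
    fix i assume "i \<in> {..n}"
    then have r: "r ^ n = r ^ i * r ^ (n - i)" by (simp add: power_add[symmetric])
    have "norm x ^ (n - i) \<le> R ^ (n - i)" using assms by (intro power_mono) auto
    then have "norm x ^ (n - i) * (norm (fps_nth bernF i) * r ^ n / fact (n - i)) \<le> R ^ (n - i) * (norm (fps_nth bernF i) * r ^ n / fact (n - i))"
      using assms by (intro mult_right_mono) auto
    then show "norm (fps_nth bernF i * (x ^ (n - i) / fact (n - i))) * r ^ n
        \<le> norm (fps_nth bernF i) * r ^ i * ((R * r) ^ (n - i) / fact (n - i))"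
      unfolding r by (simp add: norm_mult norm_divide norm_power power_mult_distrib mult_ac)
  qed
  finally show ?thesis .
qed

text \<open>The coefficient for \<open>n = 0\<close> is \<open>0\<close>, by the convention \<open>x / 0 = 0\<close>.\<close>

definition rem_coeff :: "nat \<Rightarrow> complex \<Rightarrow> complex" where
  "rem_coeff n x = (1 / fact n + bern_poly n x) / of_nat n"

text \<open>A Cauchy product of the absolute Bernoulli series at r with the exponential series at R
  * r. Its sum is explicit: it is finite for r < 2 pi, which gives uniform convergence on discs, and
  it depends on R only through exp (R * r), which gives the exponential type.\<close>

definition rem_major :: "real \<Rightarrow> real \<Rightarrow> nat \<Rightarrow> real" where
  "rem_major R r n = r ^ n / fact n +
     (\<Sum>i\<le>n. (norm (fps_nth bernF i) * r ^ i) * ((R * r) ^ (n - i) / fact (n - i)))"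

lemma rem_coeff_bound:
  assumes "norm x \<le> R" "0 \<le> r"
  shows "norm (rem_coeff n x) * r ^ n \<le> rem_major R r n"
proof -
  have R: "0 \<le> R" using assms norm_ge_zero order_trans by blast
  have "norm (rem_coeff n x) \<le> norm (1 / fact n + bern_poly n x)"
  proof (cases "n = 0")
    case False
    then show ?thesis
      unfolding rem_coeff_def norm_divide norm_of_nat
      by (simp add: divide_le_eq mult_le_cancel_left1)
  qed (simp add: rem_coeff_def)
  also have "\<dots> \<le> 1 / fact n + norm (bern_poly n x)"
    by (rule order_trans[OF norm_triangle_ineq]) (simp add: norm_divide)
  finally have "norm (rem_coeff n x) * r ^ n \<le> (1 / fact n + norm (bern_poly n x)) * r ^ n"
    using assms by (intro mult_right_mono) auto
  also have "\<dots> = r ^ n / fact n + norm (bern_poly n x) * r ^ n" by (simp add: algebra_simps)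
  also have "\<dots> \<le> rem_major R r n"
    unfolding rem_major_def using bern_poly_bound[OF assms] by simp
  finally show ?thesis .
qed

lemma rem_major_sums:
  assumes "0 \<le> R" "0 \<le> r" "r < 2 * pi"
  shows "rem_major R r sums (exp r + (\<Sum>n. norm (fps_nth bernF n) * r ^ n) * exp (R * r))"
proof -
  have e: "(\<lambda>n. s ^ n / fact n) sums exp s" for s :: real
    using exp_converges[of s] by (simp add: divide_inverse mult.commute scaleR_conv_of_real)
  have s1: "summable (\<lambda>n. norm (norm (fps_nth bernF n) * r ^ n))"
    using bern_norm_summable[of r] assms by (simp add: abs_mult)
  have s2: "summable (\<lambda>n. norm ((R * r) ^ n / fact n))"
    using e[of "R * r"] assms by (simp add: abs_mult sums_iff)
  have "(\<lambda>n. \<Sum>i\<le>n. (norm (fps_nth bernF i) * r ^ i) * ((R * r) ^ (n - i) / fact (n - i))) sums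
     ((\<Sum>n. norm (fps_nth bernF n) * r ^ n) * (\<Sum>n. (R * r) ^ n / fact n))"
    by (rule Cauchy_product_sums[OF s1 s2])
  moreover have "(\<Sum>n. (R * r) ^ n / fact n) = exp (R * r)" using e by (simp add: sums_iff)
  ultimately show ?thesis
    unfolding rem_major_def[abs_def] by (intro sums_add[OF e]) simp
qed

text \<open>This is \<open>exp (x * z) / (1 - exp z) + exp z / z\<close>, the remainder of
  \<open>exp (x * z)\<close>, integrated in z from 0. Its coefficients are those of
  \<open>bern_fun z * exp (x * z) + exp z\<close>, divided by z and then by n in the integration;
  their constant term is -1 + 1 = 0, so no logarithm of z appears.\<close>

definition rem_series :: "complex \<Rightarrow> complex \<Rightarrow> complex" where
  "rem_series z x = (\<Sum>n. rem_coeff n x * z ^ n)"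

lemma rem_series_norm_summable:
  assumes "norm z < 2 * pi"
  shows "summable (\<lambda>n. norm (rem_coeff n x * z ^ n))"
proof (rule summable_comparison_test')
  show "summable (rem_major (norm x) (norm z))"
    using rem_major_sums[of "norm x" "norm z"] assms by (auto simp: sums_iff)
  show "norm (norm (rem_coeff n x * z ^ n)) \<le> rem_major (norm x) (norm z) n" for n
    using rem_coeff_bound[of x "norm x" "norm z" n] by (simp add: norm_mult norm_power)
qed

lemma rem_series_sums:
  assumes "norm z < 2 * pi"
  shows "(\<lambda>n. rem_coeff n x * z ^ n) sums rem_series z x"
  unfolding rem_series_def using rem_series_norm_summable[OF assms] by (simp add: summable_norm_cancel summable_sums)

text \<open>The majorant is taken with R = norm x, separately for each x, so that the rate is norm z
  itself.\<close>

lemma rem_series_bound: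
  assumes "norm z < 2 * pi"
  obtains C where "C > 0" "\<And>x. norm (rem_series z x) \<le> C * exp (norm z * norm x)"
proof
  define S where "S = (\<Sum>n. norm (fps_nth bernF n) * norm z ^ n)"
  have S: "S \<ge> 0" unfolding S_def
    by (intro suminf_nonneg bern_norm_summable) (use assms in simp_all)
  show "exp (norm z) + S > 0" using S by (intro add_pos_nonneg) simp_all
  fix x
  have "norm (rem_series z x) \<le> (\<Sum>n. norm (rem_coeff n x * z ^ n))"
    unfolding rem_series_def by (rule summable_norm[OF rem_series_norm_summable[OF assms]])
  also have "\<dots> \<le> (\<Sum>n. rem_major (norm x) (norm z) n)"
  proof (intro suminf_le rem_series_norm_summable assms)
    show "summable (rem_major (norm x) (norm z))"
      using rem_major_sums[of "norm x" "norm z"] assms by (auto simp: sums_iff)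
    show "norm (rem_coeff n x * z ^ n) \<le> rem_major (norm x) (norm z) n" for n
      using rem_coeff_bound[of x "norm x" "norm z" n] by (simp add: norm_mult norm_power)
  qed
  also have "\<dots> = exp (norm z) * 1 + S * exp (norm z * norm x)"
    using rem_major_sums[of "norm x" "norm z"] assms by (simp add: sums_iff S_def mult.commute)
  also have "\<dots> \<le> exp (norm z) * exp (norm z * norm x) + S * exp (norm z * norm x)"
    by (intro add_mono mult_left_mono order_refl) simp_all
  finally show "norm (rem_series z x) \<le> (exp (norm z) + S) * exp (norm z * norm x)"
    by (simp add: algebra_simps)
qed

lemma holomorphic_rem_coeff: "rem_coeff n holomorphic_on A"
  unfolding rem_coeff_def bern_poly_def divide_inverse by (intro holomorphic_intros)

lemma uniform_limit_rem_series:
  assumes "norm z < 2 * pi" "\<And>x. x \<in> A \<Longrightarrow> norm x \<le> R" "0 \<le> R"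
  shows "uniform_limit A (\<lambda>n x. \<Sum>i<n. rem_coeff i x * z ^ i) (rem_series z) sequentially"
proof -
  have "uniform_limit A (\<lambda>n x. \<Sum>i<n. rem_coeff i x * z ^ i) (\<lambda>x. suminf (\<lambda>i. rem_coeff i x * z ^ i)) sequentially"
  proof (rule Weierstrass_m_test)
    show "summable (rem_major R (norm z))"
      using rem_major_sums[of R "norm z"] assms by (auto simp: sums_iff)
    show "norm (rem_coeff n x * z ^ n) \<le> rem_major R (norm z) n" if "x \<in> A" for n x
      using rem_coeff_bound[OF assms(2)[OF that], of "norm z" n] by (simp add: norm_mult norm_power)
  qed
  then show ?thesis by (simp add: rem_series_def[abs_def])
qed

lemma holomorphic_rem_series:
  assumes "norm z < 2 * pi"
  shows "rem_series z holomorphic_on UNIV"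
proof (rule holomorphic_uniform_sequence)
  show "(\<lambda>x. \<Sum>i<n. rem_coeff i x * z ^ i) holomorphic_on UNIV" for n
    by (intro holomorphic_intros holomorphic_rem_coeff)
  show "\<exists>d. 0 < d \<and> cball x d \<subseteq> UNIV \<and>
     uniform_limit (cball x d) (\<lambda>n x. \<Sum>i<n. rem_coeff i x * z ^ i) (rem_series z) sequentially" for x
  proof (intro exI conjI)
    show "uniform_limit (cball x 1) (\<lambda>n x. \<Sum>i<n. rem_coeff i x * z ^ i) (rem_series z) sequentially"
    proof (rule uniform_limit_rem_series[OF assms, of _ "norm x + 1"])
      fix y assume "y \<in> cball x 1"
      then show "norm y \<le> norm x + 1"
        using norm_triangle_ineq2[of y x] by (simp add: dist_norm norm_minus_commute)
    qed auto
  qed auto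
qed auto

lemma rem_series_0_left: "rem_series 0 x = 0"
proof -
  have "(\<lambda>n. rem_coeff n x * 0 ^ n) sums rem_coeff 0 x"
    using powser_sums_zero[of "\<lambda>n. rem_coeff n x"] by simp
  then show ?thesis using sums_unique rem_series_def by (metis rem_coeff_def div_by_0 of_nat_0)
qed

text \<open>The constants 1 / n! cancel in the difference, and \<open>bern_poly_diff\<close> leaves
  the exponential series without its first term. The missing 1 / x is supplied by -
  \<open>Digamma\<close> in \<open>inv_remainder\<close>.\<close>

lemma rem_series_diff:
  assumes "norm z < 2 * pi" "x \<noteq> 0"
  shows "rem_series z x - rem_series z (x + 1) = (exp (x * z) - 1) / x"
proof -
  have 1: "(\<lambda>n. rem_coeff n x * z ^ n - rem_coeff n (x + 1) * z ^ n) sums (rem_series z x - rem_series z (x + 1))"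
    by (intro sums_diff rem_series_sums assms)
  have "(\<lambda>n. (x * z) ^ n /\<^sub>R fact n) sums exp (x * z)" by (rule exp_converges)
  then have "(\<lambda>n. (x * z) ^ Suc n /\<^sub>R fact (Suc n)) sums (exp (x * z) - 1)"
    by (subst sums_Suc_iff) simp
  then have "(\<lambda>n. ((x * z) ^ Suc n /\<^sub>R fact (Suc n)) / x) sums ((exp (x * z) - 1) / x)"
    by (rule sums_divide)
  moreover have "((x * z) ^ Suc n /\<^sub>R fact (Suc n)) / x =
      rem_coeff (Suc n) x * z ^ Suc n - rem_coeff (Suc n) (x + 1) * z ^ Suc n" for n
  proof -
    have "rem_coeff (Suc n) x - rem_coeff (Suc n) (x + 1) = (bern_poly (Suc n) x - bern_poly (Suc n) (x + 1)) / of_nat (Suc n)"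
      by (simp add: rem_coeff_def field_simps del: of_nat_Suc fact_Suc)
    also have "\<dots> = x ^ n / fact (Suc n)"
      unfolding bern_poly_diff by (simp add: field_simps)
    finally show ?thesis
      using assms(2) unfolding left_diff_distrib[symmetric]
      by (simp add: scaleR_conv_of_real divide_inverse power_mult_distrib mult_ac del: fact_Suc)
  qed
  ultimately have "(\<lambda>n. rem_coeff (Suc n) x * z ^ Suc n - rem_coeff (Suc n) (x + 1) * z ^ Suc n) sums ((exp (x * z) - 1) / x)"
    by simp
  then have "(\<lambda>n. rem_coeff n x * z ^ n - rem_coeff n (x + 1) * z ^ n) sums ((exp (x * z) - 1) / x)"
    by (subst (asm) sums_Suc_iff) (simp add: rem_coeff_def)
  with 1 show ?thesis by (rule sums_unique2)
qed

section \<open>Termwise integration over the interval from 1 to 2\<close>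

lemma integral_suminf:
  fixes g :: "nat \<Rightarrow> real \<Rightarrow> complex"
  assumes cont: "\<And>n. continuous_on {a..b} (g n)"
    and bound: "\<And>n t. t \<in> {a..b} \<Longrightarrow> norm (g n t) \<le> M n"
    and M: "summable M"
  shows "(\<lambda>n. integral {a..b} (g n)) sums integral {a..b} (\<lambda>t. \<Sum>n. g n t)"
proof -
  have u: "uniform_limit {a..b} (\<lambda>n t. \<Sum>i<n. g i t) (\<lambda>t. \<Sum>n. g n t) sequentially"
    by (rule Weierstrass_m_test[OF bound M])
  obtain I J where I: "\<And>n. ((\<lambda>t. \<Sum>i<n. g i t) has_integral I n) {a..b}"
    and J: "((\<lambda>t. \<Sum>n. g n t) has_integral J) {a..b}" and IJ: "I \<longlonglongrightarrow> J"
    by (rule uniform_limit_integral[OF u]) (auto intro!: continuous_on_sum cont)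
  have "I n = (\<Sum>i<n. integral {a..b} (g i))" for n
  proof -
    have "integral {a..b} (\<lambda>t. \<Sum>i<n. g i t) = (\<Sum>i<n. integral {a..b} (g i))"
      by (intro integral_sum integrable_continuous_interval cont) auto
    with I[of n] show ?thesis by (simp add: integral_unique)
  qed
  then have "I = (\<lambda>n. \<Sum>i<n. integral {a..b} (g i))" by auto
  with IJ J show ?thesis by (simp add: sums_def integral_unique)
qed

lemma continuous_on_rem_coeff: "continuous_on A (rem_coeff n)"
  by (rule holomorphic_on_imp_continuous_on[OF holomorphic_rem_coeff])

lemma rem_coeff_0: "rem_coeff 0 x = 0"
  by (simp add: rem_coeff_def)

lemma has_integral_FTC_complex:
  fixes f F :: "complex \<Rightarrow> complex" and a b :: real
  assumes "a \<le> b" "\<And>t. t \<in> {a..b} \<Longrightarrow> (F has_field_derivative f (of_real t)) (at (of_real t))"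
  shows "((\<lambda>t. f (of_real t)) has_integral (F (of_real b) - F (of_real a))) {a..b}"
  using assms
  by (intro fundamental_theorem_of_calculus) (auto intro!: has_vector_derivative_at_within has_vector_derivative_real_field)

text \<open>This is the reason for the summand 1 / n! in \<open>rem_coeff\<close>: a primitive of
  \<open>bern_poly n\<close> is \<open>bern_poly (Suc n)\<close>, whose increment from 1 to 2 is - 1
  / n!.\<close>

lemma rem_coeff_has_integral: "((\<lambda>t. rem_coeff n (of_real t)) has_integral 0) {1..2}"
proof (cases n)
  case 0
  then show ?thesis by (simp add: rem_coeff_0)
next
  case (Suc m)
  have "((\<lambda>t. bern_poly n (of_real t)) has_integral (bern_poly (Suc n) (of_real 2) - bern_poly (Suc n) (of_real 1))) {1..2}"
    by (rule has_integral_FTC_complex) (auto intro: bern_poly_has_field_derivative)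
  also have "bern_poly (Suc n) (of_real 2) - bern_poly (Suc n) (of_real 1) = - (1 / fact n)"
    using bern_poly_diff[of n 1] by (simp add: algebra_simps)
  finally have "((\<lambda>t. 1 / fact n + bern_poly n (of_real t)) has_integral ((2 - 1) *\<^sub>R (1 / fact n) + - (1 / fact n))) {1..2}"
    by (intro has_integral_add) (use has_integral_const_real[of "1 / fact n :: complex" 1 2] in auto)
  then have "((\<lambda>t. (1 / fact n + bern_poly n (of_real t)) * inverse (of_nat n)) has_integral (0 * inverse (of_nat n))) {1..2}"
    by (intro has_integral_mult_left) simp
  then show ?thesis by (simp add: rem_coeff_def[abs_def] divide_inverse)
qed

lemma continuous_on_rem_series:
  assumes "norm z < 2 * pi" shows "continuous_on A (rem_series z)"
  using holomorphic_on_imp_continuous_on[OF holomorphic_rem_series[OF assms]] continuous_on_subset by blast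

lemma rem_series_has_integral:
  assumes "norm z < 2 * pi"
  shows "((\<lambda>t. rem_series z (of_real t)) has_integral 0) {1..2}"
proof -
  have "(\<lambda>n. integral {1..2::real} (\<lambda>t. rem_coeff n (of_real t) * z ^ n)) sums
    integral {1..2} (\<lambda>t. \<Sum>n. rem_coeff n (of_real t) * z ^ n)"
  proof (rule integral_suminf)
    show "summable (rem_major 2 (norm z))"
      using rem_major_sums[of 2 "norm z"] assms by (auto simp: sums_iff)
    show "norm (rem_coeff n (of_real t) * z ^ n) \<le> rem_major 2 (norm z) n" if "t \<in> {1..2}" for n and t :: real
      using rem_coeff_bound[of "of_real t" 2 "norm z" n] that by (simp add: norm_mult norm_power)
  qed (intro continuous_intros continuous_on_compose2[OF continuous_on_rem_coeff[of UNIV]], auto)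
  moreover have "integral {1..2::real} (\<lambda>t. rem_coeff n (of_real t) * z ^ n) = 0" for n
    using rem_coeff_has_integral[of n] by (simp add: integral_unique)
  ultimately have "(\<lambda>_. 0) sums integral {1..2::real} (\<lambda>t. rem_series z (of_real t))"
    by (simp only: rem_series_def)
  then have "integral {1..2::real} (\<lambda>t. rem_series z (of_real t)) = 0"
    using sums_unique2[OF _ sums_zero] by blast
  moreover have "(\<lambda>t. rem_series z (of_real t)) integrable_on {1..2::real}"
    by (intro integrable_continuous_interval continuous_on_compose2[OF continuous_on_rem_series[OF assms, of UNIV]] continuous_intros) auto
  ultimately show ?thesis by (metis integrable_integral)
qed

section \<open>The power series in z of the integral of exp (- t z) times the remainder
  series\<close>

definition twist_coeff :: "nat \<Rightarrow> complex \<Rightarrow> complex" where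
  "twist_coeff n x = (\<Sum>i\<le>n. (- x) ^ i / fact i * rem_coeff (n - i) x)"

definition twist_integral :: "complex \<Rightarrow> complex" where
  "twist_integral z = integral {1..2} (\<lambda>t. exp (- (of_real t * z)) * rem_series z (of_real t))"

lemma twist_coeff_sums:
  assumes "norm z < 2 * pi"
  shows "(\<lambda>n. twist_coeff n x * z ^ n) sums (exp (- (x * z)) * rem_series z x)"
proof -
  have s1: "summable (\<lambda>n. norm ((- x * z) ^ n /\<^sub>R fact n))" by (rule summable_norm_exp)
  have "(\<lambda>n. \<Sum>i\<le>n. ((- x * z) ^ i /\<^sub>R fact i) * (rem_coeff (n - i) x * z ^ (n - i))) sums
     ((\<Sum>n. (- x * z) ^ n /\<^sub>R fact n) * (\<Sum>n. rem_coeff n x * z ^ n))"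
    by (rule Cauchy_product_sums[OF s1 rem_series_norm_summable[OF assms]])
  moreover have "(\<Sum>i\<le>n. ((- x * z) ^ i /\<^sub>R fact i) * (rem_coeff (n - i) x * z ^ (n - i))) = twist_coeff n x * z ^ n" for n
    unfolding twist_coeff_def sum_distrib_right
  proof (rule sum.cong)
    fix i assume "i \<in> {..n}"
    then have z: "z ^ n = z ^ i * z ^ (n - i)" by (simp add: power_add[symmetric])
    show "((- x * z) ^ i /\<^sub>R fact i) * (rem_coeff (n - i) x * z ^ (n - i)) = (- x) ^ i / fact i * rem_coeff (n - i) x * z ^ n"
      unfolding z power_mult_distrib by (simp add: scaleR_conv_of_real divide_inverse)
  qed simp
  ultimately show ?thesis by (simp add: rem_series_def exp_def)
qed

lemma twist_coeff_bound:
  assumes "norm x \<le> R" "0 \<le> r"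
  shows "norm (twist_coeff n x) * r ^ n \<le> (\<Sum>i\<le>n. ((R * r) ^ i / fact i) * rem_major R r (n - i))"
proof -
  have R: "0 \<le> R" using assms norm_ge_zero order_trans by blast
  have "norm (twist_coeff n x) * r ^ n \<le> (\<Sum>i\<le>n. norm ((- x) ^ i / fact i * rem_coeff (n - i) x)) * r ^ n"
    unfolding twist_coeff_def by (intro mult_right_mono norm_sum) (use assms in auto)
  also have "\<dots> \<le> (\<Sum>i\<le>n. ((R * r) ^ i / fact i) * rem_major R r (n - i))"
    unfolding sum_distrib_right
  proof (rule sum_mono)
    fix i assume "i \<in> {..n}"
    then have r: "r ^ n = r ^ i * r ^ (n - i)" by (simp add: power_add[symmetric])
    have "norm ((- x) ^ i / fact i * rem_coeff (n - i) x) * r ^ n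
        = (norm x ^ i * (r ^ i / fact i)) * (norm (rem_coeff (n - i) x) * r ^ (n - i))"
      unfolding r by (simp add: norm_mult norm_divide norm_power)
    also have "\<dots> \<le> (R ^ i * (r ^ i / fact i)) * rem_major R r (n - i)"
      using assms R by (intro mult_mono rem_coeff_bound power_mono) auto
    finally show "norm ((- x) ^ i / fact i * rem_coeff (n - i) x) * r ^ n
        \<le> ((R * r) ^ i / fact i) * rem_major R r (n - i)"
      by (simp add: power_mult_distrib)
  qed
  finally show ?thesis .
qed

lemma continuous_on_twist_coeff: "continuous_on A (twist_coeff n)"
  unfolding twist_coeff_def by (intro continuous_intros continuous_on_rem_coeff) auto

lemma twist_integral_sums:
  assumes "norm z < 2 * pi"
  shows "(\<lambda>n. integral {1..2} (\<lambda>t. twist_coeff n (of_real t)) * z ^ n) sums twist_integral z"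
proof -
  define M where "M n = (\<Sum>i\<le>n. ((2 * norm z) ^ i / fact i) * rem_major 2 (norm z) (n - i))" for n
  have M: "summable M"
  proof -
    have "summable (\<lambda>n. norm ((2 * norm z) ^ n / fact n))"
      using summable_norm_exp[of "2 * norm z"] by (simp add: divide_inverse mult.commute abs_mult)
    moreover have "rem_major 2 (norm z) n \<ge> 0" for n
      unfolding rem_major_def by (intro add_nonneg_nonneg sum_nonneg) auto
    then have "summable (\<lambda>n. norm (rem_major 2 (norm z) n))"
      using rem_major_sums[of 2 "norm z"] assms by (auto simp: sums_iff)
    ultimately show ?thesis unfolding M_def by (rule summable_Cauchy_product)
  qed
  have "(\<lambda>n. integral {1..2::real} (\<lambda>t. twist_coeff n (of_real t) * z ^ n)) sums
    integral {1..2} (\<lambda>t. \<Sum>n. twist_coeff n (of_real t) * z ^ n)"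
  proof (rule integral_suminf[OF _ _ M])
    show "norm (twist_coeff n (of_real t) * z ^ n) \<le> M n" if "t \<in> {1..2}" for n and t :: real
      using twist_coeff_bound[of "of_real t" 2 "norm z" n] that by (simp add: norm_mult norm_power M_def)
  qed (intro continuous_intros continuous_on_compose2[OF continuous_on_twist_coeff[of UNIV]], auto)
  moreover have "integral {1..2::real} (\<lambda>t. twist_coeff n (of_real t) * z ^ n) = integral {1..2} (\<lambda>t. twist_coeff n (of_real t)) * z ^ n" for n
    by simp
  moreover have "(\<Sum>n. twist_coeff n x * z ^ n) = exp (- (x * z)) * rem_series z x" for x
    using twist_coeff_sums[OF assms] by (simp add: sums_iff)
  ultimately show ?thesis by (simp add: twist_integral_def)
qed

section \<open>Functions given by polynomials with rational coefficients\<close>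

definition rat_poly_fun :: "(complex \<Rightarrow> complex) \<Rightarrow> bool" where
  "rat_poly_fun f \<longleftrightarrow> (\<exists>p. (\<forall>i. coeff p i \<in> \<rat>) \<and> f = poly p)"

named_theorems rat_poly_intros

lemma rat_poly_fun_const [rat_poly_intros]: "c \<in> \<rat> \<Longrightarrow> rat_poly_fun (\<lambda>_. c)"
  unfolding rat_poly_fun_def by (intro exI[of _ "[:c:]"]) (auto simp: coeff_pCons split: nat.split)

lemma rat_poly_fun_ident [rat_poly_intros]: "rat_poly_fun (\<lambda>x. x)"
  unfolding rat_poly_fun_def by (intro exI[of _ "[:0, 1:]"]) (auto simp: coeff_pCons split: nat.split)

lemma rat_poly_fun_add [rat_poly_intros]:
  assumes "rat_poly_fun f" "rat_poly_fun g" shows "rat_poly_fun (\<lambda>x. f x + g x)"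
proof -
  from assms obtain p q where "\<forall>i. coeff p i \<in> \<rat>" "f = poly p" "\<forall>i. coeff q i \<in> \<rat>" "g = poly q"
    unfolding rat_poly_fun_def by blast
  then show ?thesis unfolding rat_poly_fun_def by (intro exI[of _ "p + q"]) auto
qed

lemma rat_poly_fun_mult [rat_poly_intros]:
  assumes "rat_poly_fun f" "rat_poly_fun g" shows "rat_poly_fun (\<lambda>x. f x * g x)"
proof -
  from assms obtain p q where "\<forall>i. coeff p i \<in> \<rat>" "f = poly p" "\<forall>i. coeff q i \<in> \<rat>" "g = poly q"
    unfolding rat_poly_fun_def by blast
  then show ?thesis unfolding rat_poly_fun_def
    by (intro exI[of _ "p * q"]) (auto simp: coeff_mult intro!: Rats_sum)
qed

lemma rat_poly_fun_power [rat_poly_intros]: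
  "rat_poly_fun f \<Longrightarrow> rat_poly_fun (\<lambda>x. f x ^ n)"
  by (induction n) (auto intro!: rat_poly_intros)

lemma rat_poly_fun_sum [rat_poly_intros]:
  "(\<And>i. i \<in> A \<Longrightarrow> rat_poly_fun (f i)) \<Longrightarrow> rat_poly_fun (\<lambda>x. \<Sum>i\<in>A. f i x)"
  by (induction A rule: infinite_finite_induct) (auto intro!: rat_poly_intros)

text \<open>The endpoints 1 and 2 are rational, so each monomial has a rational integral.\<close>

lemma rat_poly_fun_integral:
  assumes "rat_poly_fun f"
  shows "integral {1..2::real} (\<lambda>t. f (of_real t)) \<in> \<rat>"
proof -
  obtain p where p: "\<And>i. coeff p i \<in> \<rat>" "f = poly p"
    using assms unfolding rat_poly_fun_def by blast
  have mono: "((\<lambda>t. coeff p i * complex_of_real t ^ i) has_integral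
      coeff p i * ((2 ^ Suc i - 1) / of_nat (Suc i))) {1..2}" for i
  proof -
    have "((\<lambda>x. x ^ Suc i / of_nat (Suc i)) has_field_derivative x ^ i) (at x)" for x :: complex
      using DERIV_cdivide[OF DERIV_power[OF DERIV_ident, of "Suc i" x UNIV], of "of_nat (Suc i)"]
      by (simp del: power_Suc of_nat_Suc)
    then have "((\<lambda>t. complex_of_real t ^ i) has_integral
        (of_real 2 ^ Suc i / of_nat (Suc i) - of_real 1 ^ Suc i / of_nat (Suc i))) {1..2}"
      by (intro has_integral_FTC_complex) auto
    then have "((\<lambda>t. complex_of_real t ^ i) has_integral ((2 ^ Suc i - 1) / of_nat (Suc i))) {1..2}"
      by (simp add: diff_divide_distrib del: power_Suc of_nat_Suc)
    then show ?thesis by (rule has_integral_mult_right)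
  qed
  have "((\<lambda>t. \<Sum>i\<le>degree p. coeff p i * complex_of_real t ^ i) has_integral
      (\<Sum>i\<le>degree p. coeff p i * ((2 ^ Suc i - 1) / of_nat (Suc i)))) {1..2}"
    by (intro has_integral_sum mono) auto
  then have "integral {1..2} (\<lambda>t. f (of_real t)) = (\<Sum>i\<le>degree p. coeff p i * ((2 ^ Suc i - 1) / of_nat (Suc i)))"
    unfolding p(2) poly_altdef by (rule integral_unique)
  also have "\<dots> \<in> \<rat>"
    by (intro Rats_sum Rats_mult p Rats_divide Rats_diff Rats_power) auto
  finally show ?thesis .
qed

lemma rat_poly_fun_rem_coeff [rat_poly_intros]: "rat_poly_fun (rem_coeff n)"
proof -
  have "rem_coeff n = (\<lambda>x. (1 / fact n + (\<Sum>i\<le>n. fps_nth bernF i * (x ^ (n - i) * (1 / fact (n - i))))) * (1 / of_nat n))"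
    by (simp add: rem_coeff_def[abs_def] bern_poly_def[abs_def])
  moreover have "rat_poly_fun \<dots>"
    by (intro rat_poly_intros bernF_nth_rat Rats_divide) auto
  ultimately show ?thesis by (simp only:)
qed

lemma twist_coeff_integral_rat: "integral {1..2::real} (\<lambda>t. twist_coeff n (of_real t)) \<in> \<rat>"
proof (rule rat_poly_fun_integral)
  have "twist_coeff n = (\<lambda>x. \<Sum>i\<le>n. (((- 1) * x) ^ i * (1 / fact i)) * rem_coeff (n - i) x)"
    by (simp add: twist_coeff_def[abs_def])
  moreover have "rat_poly_fun \<dots>"
    by (intro rat_poly_intros Rats_divide) auto
  ultimately show "rat_poly_fun (twist_coeff n)" by (simp only:)
qed

text \<open>With the vanishing of the first two twisted integrals below, this yields the value 1/2
  of \<open>sum_quotient\<close> at 0.\<close>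

lemma rem_coeff_1: "rem_coeff 1 1 = 1 / 2"
  using bernF_nth_1 by (simp add: rem_coeff_def bern_poly_def bernF_nth_0)

lemma twist_coeff_integral_0: "integral {1..2::real} (\<lambda>t. twist_coeff 0 (of_real t)) = 0"
  by (simp add: twist_coeff_def rem_coeff_0)

lemma twist_coeff_integral_1: "integral {1..2::real} (\<lambda>t. twist_coeff 1 (of_real t)) = 0"
  using rem_coeff_has_integral[of 1] by (simp add: twist_coeff_def rem_coeff_0 integral_unique)

section \<open>Exponential growth\<close>

text \<open>The line Re x = 1/2 keeps away from the singularities at 0 and leaves the base point 1
  of all primitives inside; it becomes the c of \<open>exp_type_less\<close>. The power k is
  recorded so that primitives and products can be estimated without changing the rate s.\<close>

definition growth :: "nat \<Rightarrow> real \<Rightarrow> (complex \<Rightarrow> complex) \<Rightarrow> bool" where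
  "growth k s f \<longleftrightarrow> 0 \<le> s \<and> (\<exists>C\<ge>0. \<forall>x. 1/2 < Re x \<longrightarrow> norm (f x) \<le> C * (1 + norm x) ^ k * exp (s * norm x))"

lemma growthI:
  assumes "0 \<le> s" "0 \<le> C" "\<And>x. 1/2 < Re x \<Longrightarrow> norm (f x) \<le> C * (1 + norm x) ^ k * exp (s * norm x)"
  shows "growth k s f"
  using assms unfolding growth_def by blast

lemma growthE:
  assumes "growth k s f"
  obtains C where "0 \<le> s" "0 \<le> C" "\<And>x. 1/2 < Re x \<Longrightarrow> norm (f x) \<le> C * (1 + norm x) ^ k * exp (s * norm x)"
  using assms unfolding growth_def by blast

lemma growth_mono:
  assumes "growth k s f" "k \<le> l" "s \<le> r"
  shows "growth l r f"
proof -
  from assms(1) obtain C where C: "0 \<le> s" "0 \<le> C" "\<And>x. 1/2 < Re x \<Longrightarrow> norm (f x) \<le> C * (1 + norm x) ^ k * exp (s * norm x)"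
    by (rule growthE) blast
  show ?thesis
  proof (rule growthI)
    fix x :: complex assume x: "1/2 < Re x"
    have "C * (1 + norm x) ^ k * exp (s * norm x) \<le> C * (1 + norm x) ^ l * exp (r * norm x)"
      using assms C by (intro mult_mono mult_left_mono power_increasing mult_nonneg_nonneg) (auto intro: mult_right_mono)
    with C(3)[OF x] show "norm (f x) \<le> C * (1 + norm x) ^ l * exp (r * norm x)" by linarith
  qed (use assms C in auto)
qed

lemma growth_add:
  assumes "growth k s f" "growth k s g"
  shows "growth k s (\<lambda>x. f x + g x)"
proof -
  from assms(1) obtain C where C: "0 \<le> s" "0 \<le> C" "\<And>x. 1/2 < Re x \<Longrightarrow> norm (f x) \<le> C * (1 + norm x) ^ k * exp (s * norm x)"
    by (rule growthE) blast
  from assms(2) obtain D where D: "0 \<le> D" "\<And>x. 1/2 < Re x \<Longrightarrow> norm (g x) \<le> D * (1 + norm x) ^ k * exp (s * norm x)"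
    by (rule growthE) blast
  show ?thesis
  proof (rule growthI)
    fix x :: complex assume x: "1/2 < Re x"
    show "norm (f x + g x) \<le> (C + D) * (1 + norm x) ^ k * exp (s * norm x)"
      using norm_triangle_ineq[of "f x" "g x"] C(3)[OF x] D(2)[OF x] by (simp add: distrib_right)
  qed (use C D in auto)
qed

lemma growth_mult:
  assumes "growth k s f" "growth l r g"
  shows "growth (k + l) (s + r) (\<lambda>x. f x * g x)"
proof -
  from assms(1) obtain C where C: "0 \<le> s" "0 \<le> C" "\<And>x. 1/2 < Re x \<Longrightarrow> norm (f x) \<le> C * (1 + norm x) ^ k * exp (s * norm x)"
    by (rule growthE) blast
  from assms(2) obtain D where D: "0 \<le> r" "0 \<le> D" "\<And>x. 1/2 < Re x \<Longrightarrow> norm (g x) \<le> D * (1 + norm x) ^ l * exp (r * norm x)"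
    by (rule growthE) blast
  show ?thesis
  proof (rule growthI)
    fix x :: complex assume x: "1/2 < Re x"
    have "norm (f x * g x) \<le> (C * (1 + norm x) ^ k * exp (s * norm x)) * (D * (1 + norm x) ^ l * exp (r * norm x))"
      unfolding norm_mult using C D x by (intro mult_mono) auto
    moreover have "exp ((s + r) * norm x) = exp (s * norm x) * exp (r * norm x)"
      by (simp add: distrib_right exp_add)
    ultimately show "norm (f x * g x) \<le> (C * D) * (1 + norm x) ^ (k + l) * exp ((s + r) * norm x)"
      by (simp add: power_add mult_ac)
  qed (use C D in auto)
qed

lemma growth_const: "growth 0 0 (\<lambda>_. c)"
  by (rule growthI[of 0 "norm c"]) auto

lemma growth_ident: "growth 1 0 (\<lambda>x. x)"
  by (rule growthI[of 0 1]) auto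

lemma growth_exp: "growth 0 (norm z) (\<lambda>x. exp (x * z))"
proof (rule growthI[of _ 1])
  fix x :: complex
  show "norm (exp (x * z)) \<le> 1 * (1 + norm x) ^ 0 * exp (norm z * norm x)"
    using complex_Re_le_cmod[of "x * z"] by (simp add: norm_mult mult.commute)
qed auto

text \<open>Integrate along the segment from 1 to x. The weight exp ((x - t) z) costs at most exp (s
  |x - t|) and the function e costs exp (s |t|); as |x - t| + |t| exceeds |x| by at most 2, the two
  rates do not add up and s is kept. The length of the segment costs one power. For z = 0 this
  estimates ordinary primitives such as \<open>ln\<close> and \<open>Digamma\<close>.\<close>

lemma growth_exp_primitive:
  assumes P: "\<And>x. x \<in> right_half_plane \<Longrightarrow> (P has_field_derivative exp (- (x * z)) * e x) (at x)"
    and e: "growth k s e" and z: "norm z \<le> s"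
  shows "growth (k + 1) s (\<lambda>x. exp (x * z) * P x)"
proof -
  from e obtain C where C: "0 \<le> s" "0 \<le> C" "\<And>x. 1/2 < Re x \<Longrightarrow> norm (e x) \<le> C * (1 + norm x) ^ k * exp (s * norm x)"
    by (rule growthE) blast
  show ?thesis
  proof (rule growthI)
    fix x :: complex assume x: "1/2 < Re x"
    \<comment> \<open>The two factors anticipate |x - t| + |t| <= |x| + 2 and 1 + |t| <= 2 (1 + |x|)
      on the segment.\<close>
    define B where "B = exp (s * (norm x + 2)) * (C * (2 * (1 + norm x)) ^ k)"
    have B0: "B \<ge> 0" using C by (simp add: B_def)
    have "norm (exp (x * z) * P x - exp (x * z) * P 1) \<le> B * norm (x - 1)"
    proof (rule field_differentiable_bound[OF convex_closed_segment[of 1 x]])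
      fix t assume "t \<in> closed_segment 1 x"
      then obtain u where u: "0 \<le> u" "u \<le> 1" "t = (1 - u) *\<^sub>R 1 + u *\<^sub>R x"
        unfolding in_segment by blast
      have "Re t = (1 - u) + u * Re x" using u by simp
      moreover have "(1 - u) * 1 + u * Re x > 1/2"
      proof (cases "u = 0")
        case False
        then have "u * (Re x - 1/2) > 0" using x u by (intro mult_pos_pos) auto
        moreover have "(1 - u) / 2 \<ge> 0" using u by simp
        ultimately show ?thesis by (simp add: algebra_simps)
      qed simp
      ultimately have t: "Re t > 1/2" by simp
      then show "((\<lambda>t. exp (x * z) * P t) has_field_derivative exp (x * z) * (exp (- (t * z)) * e t)) (at t within closed_segment 1 x)"
        by (intro has_field_derivative_at_within[OF DERIV_cmult[OF P]]) (simp add: right_half_plane_def)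
      have nt: "norm t \<le> (1 - u) + u * norm x"
        unfolding u(3) using u norm_triangle_ineq[of "(1 - u) *\<^sub>R 1" "u *\<^sub>R x"] by simp
      also have "\<dots> \<le> 1 + norm x" using u mult_left_le_one_le[of "norm x" u] by simp
      also have "\<dots> \<le> 1 + 2 * norm x" by simp
      finally have nt2: "1 + norm t \<le> 2 * (1 + norm x)" by simp
      have "x - t = (1 - u) *\<^sub>R (x - 1)" unfolding u(3) by (simp add: algebra_simps)
      then have "norm (x - t) = (1 - u) * norm (x - 1)" using u by simp
      also have "\<dots> \<le> (1 - u) * (norm x + 1)"
        using u norm_triangle_ineq4[of x 1] by (intro mult_left_mono) auto
      finally have "norm (x - t) + norm t \<le> (1 - u) * (norm x + 1) + ((1 - u) + u * norm x)" using nt by simp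
      also have "\<dots> = norm x + 2 * (1 - u)" by (simp add: algebra_simps)
      finally have nn: "norm (x - t) + norm t \<le> norm x + 2" using u by simp
      have "norm (exp (x * z) * (exp (- (t * z)) * e t)) = norm (exp ((x - t) * z)) * norm (e t)"
        by (simp add: norm_mult left_diff_distrib exp_diff exp_minus divide_inverse)
      also have "\<dots> \<le> exp (s * norm (x - t)) * (C * (1 + norm t) ^ k * exp (s * norm t))"
      proof (rule mult_mono)
        have "Re ((x - t) * z) \<le> norm (x - t) * norm z"
          using complex_Re_le_cmod[of "(x - t) * z"] by (simp add: norm_mult)
        also have "\<dots> \<le> s * norm (x - t)" using z by (simp add: mult.commute mult_right_mono)
        finally show "norm (exp ((x - t) * z)) \<le> exp (s * norm (x - t))" by simp
      qed (use C t in auto)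
      also have "\<dots> = exp (s * (norm (x - t) + norm t)) * (C * (1 + norm t) ^ k)"
        by (simp add: distrib_left exp_add mult_ac)
      also have "\<dots> \<le> B" unfolding B_def
        using C nn nt2 by (intro mult_mono power_mono) (auto intro: mult_left_mono)
      finally show "norm (exp (x * z) * (exp (- (t * z)) * e t)) \<le> B" .
    qed auto
    also have "\<dots> \<le> B * (1 + norm x)"
      using B0 norm_triangle_ineq4[of x 1] by (intro mult_left_mono) auto
    finally have 1: "norm (exp (x * z) * P x - exp (x * z) * P 1) \<le> B * (1 + norm x)" .
    have 2: "norm (exp (x * z) * P 1) \<le> norm (P 1) * (1 + norm x) ^ (k + 1) * exp (s * norm x)"
    proof -
      have "Re (x * z) \<le> s * norm x"
        using complex_Re_le_cmod[of "x * z"] mult_right_mono[OF z, of "norm x"] by (simp add: norm_mult mult.commute)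
      then have "norm (exp (x * z) * P 1) \<le> (norm (P 1) * 1) * exp (s * norm x)"
        by (simp add: norm_mult mult.commute mult_left_mono)
      also have "\<dots> \<le> (norm (P 1) * (1 + norm x) ^ (k + 1)) * exp (s * norm x)"
        by (intro mult_right_mono mult_left_mono one_le_power) auto
      finally show ?thesis .
    qed
    have "B * (1 + norm x) = (C * 2 ^ k * exp (2 * s)) * (1 + norm x) ^ (k + 1) * exp (s * norm x)"
    proof -
      have "exp (s * (norm x + 2)) = exp (s * norm x) * exp (2 * s)"
        by (simp add: distrib_left exp_add mult.commute)
      then show ?thesis unfolding B_def power_mult_distrib by (simp add: mult_ac)
    qed
    with 1 2 norm_triangle_ineq[of "exp (x * z) * P x - exp (x * z) * P 1" "exp (x * z) * P 1"]
    show "norm (exp (x * z) * P x) \<le> (C * 2 ^ k * exp (2 * s) + norm (P 1)) * (1 + norm x) ^ (k + 1) * exp (s * norm x)"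
      by (simp add: distrib_right)
  qed (use C in auto)
qed

text \<open>The gap between s and \<rho> leaves room to absorb the polynomial factor into a slightly
  larger exponential rate.\<close>

lemma growth_imp_exp_type:
  assumes "growth k s f" "s < \<rho>"
  shows "exp_type_less \<rho> f"
proof -
  from assms(1) obtain C where C: "0 \<le> s" "0 \<le> C" "\<And>x. 1/2 < Re x \<Longrightarrow> norm (f x) \<le> C * (1 + norm x) ^ k * exp (s * norm x)"
    by (rule growthE) blast
  \<comment> \<open>The quotient makes k * d smaller than \<rho> - s, also for k = 0; the bound d <=
    1 gives d (1 + t) <= 1 + d t <= exp (d t).\<close>
  define d where "d = min 1 ((\<rho> - s) / (2 * (real k + 1)))"
  have d: "0 < d" "d \<le> 1" "real k * d < \<rho> - s"
  proof -
    have "real k * d \<le> real k * ((\<rho> - s) / (2 * (real k + 1)))"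
      unfolding d_def by (intro mult_left_mono) auto
    also have "\<dots> = (\<rho> - s) * (real k / (2 * (real k + 1)))" by simp
    also have "\<dots> < (\<rho> - s) * 1" using assms by (intro mult_strict_left_mono) (auto simp: divide_less_eq)
    finally show "real k * d < \<rho> - s" by simp
  qed (use assms in \<open>auto simp: d_def\<close>)
  have pw: "(1 + t) ^ k \<le> (1 / d) ^ k * exp (real k * d * t)" if "t \<ge> 0" for t
  proof -
    have "d * (1 + t) \<le> 1 + d * t" using d by (simp add: algebra_simps)
    also have "\<dots> \<le> exp (d * t)" by (rule exp_ge_add_one_self)
    finally have "1 + t \<le> (1 / d) * exp (d * t)" using d by (simp add: field_simps)
    then have "(1 + t) ^ k \<le> ((1 / d) * exp (d * t)) ^ k" using that by (intro power_mono) auto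
    then show ?thesis by (simp only: power_mult_distrib exp_of_nat_mult[symmetric] mult.assoc)
  qed
  define K where "K = (C + 1) * (1 / d) ^ k"
  have "norm (f x) \<le> K * exp ((s + real k * d) * norm x)" if "1/2 < Re x" for x
  proof -
    have "norm (f x) \<le> C * (1 + norm x) ^ k * exp (s * norm x)" by (rule C(3)[OF that])
    also have "\<dots> \<le> (C + 1) * ((1 / d) ^ k * exp (real k * d * norm x)) * exp (s * norm x)"
      using C pw[of "norm x"] by (intro mult_right_mono mult_mono) auto
    finally have "norm (f x) \<le> (C + 1) * ((1 / d) ^ k * exp (real k * d * norm x)) * exp (s * norm x)" .
    moreover have "exp ((s + real k * d) * norm x) = exp (s * norm x) * exp (real k * d * norm x)"
      by (simp add: distrib_right exp_add)
    ultimately show ?thesis by (simp add: K_def mult_ac)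
  qed
  moreover have "K > 0" using C d by (simp add: K_def)
  ultimately show ?thesis unfolding exp_type_less_def
    using d by (intro exI[of _ "1/2"] exI[of _ "s + real k * d"] exI[of _ K]) auto
qed

section \<open>The right half-plane, and growth of the logarithm and the digamma function\<close>

lemma rhp_D:
  assumes "x \<in> right_half_plane"
  shows "x \<noteq> 0" "x \<notin> \<real>\<^sub>\<le>\<^sub>0" "x \<notin> \<int>\<^sub>\<le>\<^sub>0" "x + 1 \<in> right_half_plane"
  using assms by (auto simp: right_half_plane_def complex_nonpos_Reals_iff elim!: nonpos_Ints_cases)

lemma convex_rhp: "convex right_half_plane" and open_rhp: "open right_half_plane"
  by (simp_all add: right_half_plane_def convex_halfspace_Re_gt open_halfspace_Re_gt)

lemma of_real_in_rhp: "1 \<le> t \<Longrightarrow> of_real t \<in> right_half_plane"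
  by (simp add: right_half_plane_def)

lemma growth_ln: "growth 1 0 ln"
proof -
  have "growth 0 0 (\<lambda>x. 1 / x)"
  proof (rule growthI[of _ 2])
    fix x :: complex assume "1/2 < Re x"
    then have "norm x > 1/2" using complex_Re_le_cmod[of x] by linarith
    then have "norm (1 / x) \<le> 2" by (simp add: norm_divide divide_le_eq)
    then show "norm (1 / x) \<le> 2 * (1 + norm x) ^ 0 * exp (0 * norm x)" by simp
  qed auto
  then have "growth (0 + 1) 0 (\<lambda>x. exp (x * 0) * ln x)"
    by (intro growth_exp_primitive[where e = "\<lambda>x. 1 / x"])
       (auto intro!: derivative_eq_intros dest: rhp_D simp: divide_inverse)
  then show ?thesis by simp
qed

text \<open>For Re x > 1/2 the series of 1 / (x + k)^2 is dominated termwise by its value at the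
  real point 1/2. One integration then bounds \<open>Digamma\<close>.\<close>

lemma growth_Polygamma_1: "growth 0 0 (Polygamma 1)"
proof (rule growthI)
  have S: "(\<lambda>k. inverse ((1/2 + real k) ^ Suc 1)) sums ((-1) ^ Suc 1 * Polygamma 1 (1/2) / fact 1)"
    by (rule Polygamma_LIMSEQ) auto
  show "0 \<le> Polygamma 1 (1/2 :: real)"
    using sums_le[OF _ sums_zero S] by simp
  fix x :: complex assume x: "1/2 < Re x"
  have "x \<noteq> 0" using x by auto
  then have X: "(\<lambda>k. inverse ((x + of_nat k) ^ Suc 1)) sums ((-1) ^ Suc 1 * Polygamma 1 x / fact 1)"
    by (rule Polygamma_LIMSEQ) auto
  have le: "norm (inverse ((x + of_nat k) ^ Suc 1)) \<le> inverse ((1/2 + real k) ^ Suc 1)" for k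
  proof -
    have "1/2 + real k \<le> norm (x + of_nat k)" using complex_Re_le_cmod[of "x + of_nat k"] x by simp
    then have "(1/2 + real k) ^ Suc 1 \<le> norm (x + of_nat k) ^ Suc 1" by (intro power_mono) auto
    then show ?thesis unfolding norm_inverse norm_power by (intro le_imp_inverse_le) auto
  qed
  have "norm (\<Sum>k. inverse ((x + of_nat k) ^ Suc 1)) \<le> (\<Sum>k. inverse ((1/2 + real k) ^ Suc 1))"
    using le sums_summable[OF S] by (rule norm_suminf_le)
  then show "norm (Polygamma 1 x) \<le> Polygamma 1 (1/2) * (1 + norm x) ^ 0 * exp (0 * norm x)"
    using sums_unique[OF S] sums_unique[OF X] by simp
qed auto

lemma growth_Digamma: "growth 1 0 Digamma"
proof -
  have "growth (0 + 1) 0 (\<lambda>x. exp (x * 0) * Digamma x)"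
  proof (rule growth_exp_primitive[OF _ growth_Polygamma_1])
    fix x assume "x \<in> right_half_plane"
    then show "(Digamma has_field_derivative exp (- (x * 0)) * Polygamma 1 x) (at x)"
      using has_field_derivative_Polygamma[of x 0 UNIV] rhp_D(3) by simp
  qed simp
  then show ?thesis by simp
qed

section \<open>The normalised remainder of exp (x * z) / x\<close>

definition inv_remainder :: "complex \<Rightarrow> complex \<Rightarrow> complex" where
  "inv_remainder z x = rem_series z x - Digamma x"

context
  fixes z :: complex
  assumes z: "norm z < 2 * pi"
begin

lemma growth_inv_remainder: "growth 1 (norm z) (inv_remainder z)"
proof -
  obtain C where "C > 0" "\<And>x. norm (rem_series z x) \<le> C * exp (norm z * norm x)"
    using rem_series_bound[OF z] by blast
  then have "growth 0 (norm z) (rem_series z)"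
    by (intro growthI[of _ C]) auto
  then have "growth 1 (norm z) (rem_series z)" by (rule growth_mono) auto
  moreover have "growth (0 + 1) (0 + norm z) (\<lambda>x. (-1) * Digamma x)"
    by (rule growth_mult[OF growth_const]) (rule growth_mono[OF growth_Digamma], auto)
  ultimately have "growth 1 (norm z) (\<lambda>x. rem_series z x + (-1) * Digamma x)"
    by (intro growth_add) auto
  then show ?thesis by (simp add: inv_remainder_def[abs_def])
qed

lemma holomorphic_inv_remainder: "inv_remainder z holomorphic_on right_half_plane"
  unfolding inv_remainder_def
  by (intro holomorphic_intros holomorphic_on_subset[OF holomorphic_rem_series[OF z]]) (auto dest: rhp_D)

lemma inv_remainder_diff:
  assumes "x \<in> right_half_plane"
  shows "inv_remainder z x - inv_remainder z (x + 1) = exp (x * z) / x"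
proof -
  have "inv_remainder z x - inv_remainder z (x + 1) = (rem_series z x - rem_series z (x + 1)) + (Digamma (x + 1) - Digamma x)"
    by (simp add: inv_remainder_def)
  also have "\<dots> = (exp (x * z) - 1) / x + 1 / x"
    using rem_series_diff[OF z rhp_D(1)[OF assms]] Digamma_plus1[OF rhp_D(1)[OF assms]] by simp
  finally show ?thesis by (simp add: diff_divide_distrib)
qed

lemma inv_remainder_1: "inv_remainder z 1 = rem_series z 1 + euler_mascheroni"
  by (simp add: inv_remainder_def)

end

text \<open>\<open>ln_Gamma\<close> is a primitive and vanishes at both 1 and 2. Hence -
  \<open>Digamma\<close> is the remainder of 1 / x without any additive constant.\<close>

lemma has_integral_Digamma: "((\<lambda>t. Digamma (complex_of_real t)) has_integral 0) {1..2}"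
proof -
  have "((\<lambda>t. Digamma (complex_of_real t)) has_integral (ln_Gamma (of_real 2) - ln_Gamma (of_real 1))) {1..2}"
    by (rule has_integral_FTC_complex) (auto intro!: derivative_intros dest: of_real_in_rhp rhp_D)
  moreover have "ln_Gamma (2 :: complex) = 0" "ln_Gamma (1 :: complex) = 0"
    using ln_Gamma_complex_conv_fact[of 2] ln_Gamma_complex_conv_fact[of 1] by auto
  ultimately show ?thesis by simp
qed

lemma inv_remainder_has_integral:
  assumes "norm z < 2 * pi"
  shows "((\<lambda>t. inv_remainder z (of_real t)) has_integral 0) {1..2}"
  using has_integral_diff[OF rem_series_has_integral[OF assms] has_integral_Digamma]
  by (simp add: inv_remainder_def)

section \<open>Explicit remainders\<close>

lemma ramanujan_admissible_ln:
  assumes "norm z < pi"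
  shows "ramanujan_admissible (\<lambda>x. exp (x * z) * ln x)"
proof -
  have "growth (0 + 1) (norm z + 0) (\<lambda>x. exp (x * z) * ln x)"
    by (intro growth_mult growth_exp growth_ln)
  then show ?thesis
    unfolding ramanujan_admissible_def
    using assms by (auto intro!: holomorphic_intros growth_imp_exp_type dest: rhp_D)
qed

lemma harm_interp_eq: "x \<noteq> 0 \<Longrightarrow> harm_interp x = Digamma x + euler_mascheroni + 1 / x"
  by (simp add: harm_interp_def Digamma_plus1)

lemma growth_Digamma_plus_const: "growth 1 0 (\<lambda>x. Digamma x + c)"
  by (intro growth_add growth_Digamma growth_mono[OF growth_const]) auto

lemma growth_harm_interp: "growth 1 0 harm_interp"
proof -
  obtain C where C: "0 \<le> C" "\<And>x. 1/2 < Re x \<Longrightarrow> norm (Digamma x + euler_mascheroni) \<le> C * (1 + norm x) ^ 1 * exp (0 * norm x)"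
    by (rule growthE[OF growth_Digamma_plus_const[of euler_mascheroni]]) blast
  show ?thesis
  proof (rule growthI[of _ "2 * C"])
    fix x :: complex assume "1/2 < Re x"
    then have "norm (harm_interp x) \<le> C * (1 + norm (x + 1))"
      using C(2)[of "x + 1"] by (simp add: harm_interp_def)
    also have "\<dots> \<le> C * (2 * (1 + norm x))"
    proof (intro mult_left_mono)
      have "norm (x + 1) \<le> norm x + 1" using norm_triangle_ineq[of x 1] by simp
      also have "\<dots> \<le> 1 + 2 * norm x" by simp
      finally show "1 + norm (x + 1) \<le> 2 * (1 + norm x)" by simp
    qed (rule C(1))
    finally show "norm (harm_interp x) \<le> 2 * C * (1 + norm x) ^ 1 * exp (0 * norm x)"
      by (simp add: algebra_simps)
  qed (use C in auto)
qed

lemma ramanujan_admissible_harm: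
  assumes "norm z < pi"
  shows "ramanujan_admissible (\<lambda>x. exp (- (x * z)) * harm_interp x)"
proof -
  have "growth (0 + 1) (norm (- z) + 0) (\<lambda>x. exp (x * (- z)) * harm_interp x)"
    by (intro growth_mult growth_exp growth_harm_interp)
  then have "exp_type_less pi (\<lambda>x. exp (- (x * z)) * harm_interp x)"
    using assms by (auto intro!: growth_imp_exp_type)
  moreover have "(\<lambda>x. exp (- (x * z)) * harm_interp x) holomorphic_on right_half_plane"
  proof (rule holomorphic_transform)
    show "(\<lambda>x. exp (- (x * z)) * (Digamma x + euler_mascheroni + 1 / x)) holomorphic_on right_half_plane"
      by (intro holomorphic_intros) (auto dest: rhp_D)
  qed (auto simp: harm_interp_eq dest: rhp_D)
  ultimately show ?thesis unfolding ramanujan_admissible_def by blast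
qed

text \<open>
  The hypothesis on \<open>\<kappa>\<close> says \<open>A 2 = A 1\<close>. It makes the solution \<open>A\<close> of the
  differential equation also a solution of the difference equation.
\<close>

lemma
  fixes z \<kappa> :: complex
  assumes z: "norm z < 2 * pi"
    and P: "\<And>x. x \<in> right_half_plane \<Longrightarrow> (P has_field_derivative exp (- (x * z)) * inv_remainder z x) (at x)"
    and \<kappa>: "exp z * (\<kappa> + P 2) = \<kappa> + P 1"
  defines "A \<equiv> \<lambda>x. exp (x * z) * (\<kappa> + P x)"
  shows ln_solution_deriv: "x \<in> right_half_plane \<Longrightarrow> (A has_field_derivative z * A x + inv_remainder z x) (at x)"
    and ln_solution_remainder: "((\<lambda>t. A (of_real t)) has_integral 0) {1..2} \<Longrightarrow>
      ramanujan_remainder (\<lambda>x. exp (x * z) * ln x) A"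
proof -
  show deriv: "(A has_field_derivative z * A x + inv_remainder z x) (at x)" if "x \<in> right_half_plane" for x
    unfolding A_def
    by (rule derivative_eq_intros P refl that)+ (simp add: algebra_simps flip: exp_add)
  have diff: "A x - A (x + 1) = exp (x * z) * ln x" if x: "x \<in> right_half_plane" for x
  proof -
    \<comment> \<open>Multiplied by \<open>exp (x * z)\<close> this is the defect A x - A (x + 1) -
      exp (x * z) * ln x. Without that factor its derivative is 0, by the difference equation for
      \<open>inv_remainder\<close>.\<close>
    define u where "u x = (\<kappa> + P x) - exp z * (\<kappa> + P (x + 1)) - ln x" for x
    have "(u has_field_derivative 0) (at x)" if x: "x \<in> right_half_plane" for x
    proof -
      have P1: "((\<lambda>x. P (x + 1)) has_field_derivative exp (- ((x + 1) * z)) * inv_remainder z (x + 1)) (at x)"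
        using P[OF rhp_D(4)[OF x]] by (simp add: DERIV_shift)
      have "exp (- (x * z)) * inv_remainder z x - exp z * (exp (- ((x + 1) * z)) * inv_remainder z (x + 1)) - 1 / x
        = exp (- (x * z)) * (inv_remainder z x - inv_remainder z (x + 1)) - 1 / x"
      proof -
        have "exp z * exp (- ((x + 1) * z)) = exp (- (x * z))"
          by (simp add: algebra_simps flip: exp_add)
        then show ?thesis by (simp add: right_diff_distrib flip: mult.assoc)
      qed
      also have "\<dots> = 0"
        using inv_remainder_diff[OF z x] by (simp add: exp_minus)
      finally have "exp (- (x * z)) * inv_remainder z x - exp z * (exp (- ((x + 1) * z)) * inv_remainder z (x + 1)) - 1 / x = 0" .
      moreover have "(ln has_field_derivative 1 / x) (at x)"
        using has_field_derivative_Ln[OF rhp_D(2)[OF x]] by (simp add: divide_inverse)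
      then have "(u has_field_derivative (0 + exp (- (x * z)) * inv_remainder z x)
          - exp z * (0 + exp (- ((x + 1) * z)) * inv_remainder z (x + 1)) - 1 / x) (at x)"
        unfolding u_def by (intro DERIV_diff DERIV_add DERIV_const DERIV_cmult P P1 x)
      ultimately show ?thesis by (simp only: add_0)
    qed
    then obtain c where c: "\<And>x. x \<in> right_half_plane \<Longrightarrow> u x = c"
      using has_field_derivative_zero_constant[OF convex_rhp, of u] has_field_derivative_at_within by blast
    \<comment> \<open>At 1 the logarithm is 0, and the rest is the hypothesis on \<kappa>.\<close>
    have "u 1 = 0" using \<kappa> by (simp add: u_def)
    then have "u x = 0" using c[of 1] c[OF x] by (simp add: right_half_plane_def)
    then have "exp (x * z) * u x = 0" by simp
    then show ?thesis by (simp add: A_def u_def algebra_simps exp_add)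
  qed
  have "growth (1 + 1) (norm z) (\<lambda>x. exp (x * z) * P x)"
    by (rule growth_exp_primitive[OF P growth_inv_remainder[OF z]]) auto
  moreover have "growth (1 + 1) (norm z) (\<lambda>x. exp (x * z) * \<kappa>)"
    using growth_mult[OF growth_exp growth_const] by (rule growth_mono) auto
  ultimately have "growth (1 + 1) (norm z) (\<lambda>x. exp (x * z) * \<kappa> + exp (x * z) * P x)"
    by (intro growth_add)
  then have "growth 2 (norm z) A"
    by (simp only: A_def distrib_left one_add_one)
  then have gr: "exp_type_less (2 * pi) A" using z by (rule growth_imp_exp_type)
  show "ramanujan_remainder (\<lambda>x. exp (x * z) * ln x) A" if "((\<lambda>t. A (of_real t)) has_integral 0) {1..2}"
    unfolding ramanujan_remainder_def
    using that gr diff deriv open_rhp by (auto simp: holomorphic_on_open)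
qed

lemma inv_remainder_primitive:
  assumes "norm z < 2 * pi"
  obtains P where "\<And>x. x \<in> right_half_plane \<Longrightarrow> (P has_field_derivative exp (- (x * z)) * inv_remainder z x) (at x)"
    "P 1 = 0"
proof -
  have "(\<lambda>x. exp (- (x * z)) * inv_remainder z x) holomorphic_on right_half_plane"
    by (intro holomorphic_intros holomorphic_inv_remainder assms)
  then obtain g where g: "\<And>x. x \<in> right_half_plane \<Longrightarrow>
      (g has_field_derivative exp (- (x * z)) * inv_remainder z x) (at x within right_half_plane)"
    using holomorphic_convex_primitive'[OF convex_rhp open_rhp] by blast
  show thesis
  proof (rule that[of "\<lambda>x. g x - g 1"])
    fix x assume x: "x \<in> right_half_plane"
    have "(g has_field_derivative exp (- (x * z)) * inv_remainder z x) (at x)"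
      using g[OF x] by (simp only: at_within_open[OF x open_rhp])
    then show "((\<lambda>x. g x - g 1) has_field_derivative exp (- (x * z)) * inv_remainder z x) (at x)"
      by (auto intro!: derivative_eq_intros)
  qed simp
qed

definition digamma_transform :: "complex \<Rightarrow> complex" where
  "digamma_transform z = integral {1..2} (\<lambda>t. exp (- (of_real t * z)) * Digamma (of_real t))"

lemma digamma_transform_has_integral:
  "((\<lambda>t. exp (- (of_real t * z)) * Digamma (of_real t)) has_integral digamma_transform z) {1..2}"
  unfolding digamma_transform_def
  by (intro integrable_integral integrable_continuous_interval continuous_intros
      continuous_on_compose2[OF continuous_on_Polygamma[of right_half_plane]])
     (auto dest: of_real_in_rhp rhp_D)

lemma twist_integral_has_integral:
  assumes "norm z < 2 * pi"
  shows "((\<lambda>t. exp (- (of_real t * z)) * rem_series z (of_real t)) has_integral twist_integral z) {1..2}"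
  unfolding twist_integral_def
  by (intro integrable_integral integrable_continuous_interval continuous_intros
      continuous_on_compose2[OF continuous_on_rem_series[OF assms, of UNIV]]) auto

lemma one_minus_exp_ne_0:
  fixes z :: complex
  assumes "norm z < pi" "z \<noteq> 0"
  shows "1 - exp z \<noteq> 0" "1 - exp (- z) \<noteq> 0"
  using exp_ne_1[of z] exp_ne_1[of "- z"] assms pi_gt_zero by auto

lemma ramanujan_sum_ln:
  assumes z: "norm z < pi" "z \<noteq> 0"
  shows "ramanujan_sum (\<lambda>x. exp (x * z) * ln x) =
    exp z * (digamma_transform z - twist_integral z) / (1 - exp (- z))"
proof -
  have z2: "norm z < 2 * pi" using z pi_gt_zero by linarith
  obtain P where P: "\<And>x. x \<in> right_half_plane \<Longrightarrow> (P has_field_derivative exp (- (x * z)) * inv_remainder z x) (at x)"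
    and P1: "P 1 = 0" using inv_remainder_primitive[OF z2] by blast
  \<comment> \<open>The solution of the condition A 2 = A 1 when P 1 = 0; it exists because z
    \<noteq> 0 keeps 1 - exp z away from 0.\<close>
  define \<kappa> where "\<kappa> = exp z * P 2 / (1 - exp z)"
  note nz = one_minus_exp_ne_0[OF z]
  have k: "exp z * (\<kappa> + P 2) = \<kappa> + P 1"
    using nz by (simp add: \<kappa>_def P1 field_simps)
  define A where "A x = exp (x * z) * (\<kappa> + P x)" for x
  note sol = ln_solution_deriv[OF z2 P k, folded A_def] ln_solution_remainder[OF z2 P k, folded A_def]
  have A2: "A 2 = A 1" using k by (simp add: A_def exp_double power2_eq_square mult.assoc flip: exp_of_nat_mult)
  \<comment> \<open>The integrand is A', so the integral is A 2 - A 1 = 0. Since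
    \<open>inv_remainder\<close> has mean 0, so does z A, and z \<noteq> 0 can be divided out: the
    normalisation holds without further adjustment.\<close>
  have "((\<lambda>t. z * A (of_real t) + inv_remainder z (of_real t)) has_integral (A (of_real 2) - A (of_real 1))) {1..2}"
    by (rule has_integral_FTC_complex) (auto intro: sol(1) of_real_in_rhp)
  from has_integral_diff[OF this inv_remainder_has_integral[OF z2]]
  have "((\<lambda>t. z * A (of_real t)) has_integral 0) {1..2}" by (simp add: A2)
  from has_integral_mult_right[OF this, of "inverse z"]
  have "((\<lambda>t. A (of_real t)) has_integral 0) {1..2}"
    using z(2) by (simp flip: mult.assoc)
  then have "ramanujan_sum (\<lambda>x. exp (x * z) * ln x) = A 1"
    by (intro ramanujan_sum_eqI ramanujan_admissible_ln sol(2) z)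
  moreover have "P 2 = twist_integral z - digamma_transform z"
  proof -
    have "((\<lambda>t. exp (- (of_real t * z)) * inv_remainder z (of_real t)) has_integral (P (of_real 2) - P (of_real 1))) {1..2}"
      by (rule has_integral_FTC_complex) (auto intro: P of_real_in_rhp)
    moreover have "((\<lambda>t. exp (- (of_real t * z)) * inv_remainder z (of_real t)) has_integral (twist_integral z - digamma_transform z)) {1..2}"
      using has_integral_diff[OF twist_integral_has_integral[OF z2] digamma_transform_has_integral[of z]]
      by (simp add: inv_remainder_def right_diff_distrib)
    ultimately have "P (of_real 2) - P (of_real 1) = twist_integral z - digamma_transform z"
      by (rule has_integral_unique)
    then show ?thesis using P1 by simp
  qed
  moreover have "A 1 = exp z * (- P 2) / (1 - exp (- z))"
    using nz by (simp add: A_def P1 \<kappa>_def exp_minus field_simps)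
  ultimately show ?thesis by (simp only: minus_diff_eq)
qed

text \<open>The difference of exp (- x z) (Digamma x + gamma) is the summand times 1 - exp (- z),
  minus exp (- x z) / x. Adding the remainder of the last term gives N, which is 1 - exp (- z) times
  a remainder that is not yet normalised.\<close>

lemma ramanujan_sum_harm:
  assumes z: "norm z < pi" "z \<noteq> 0"
  shows "ramanujan_sum (\<lambda>x. exp (- (x * z)) * harm_interp x) =
    (euler_mascheroni + rem_series (- z) 1 - digamma_transform z) / (1 - exp (- z)) - euler_mascheroni * exp (- z) / z"
proof -
  have z2: "norm (- z) < 2 * pi" using z pi_gt_zero unfolding norm_minus_cancel by linarith
  note nz = one_minus_exp_ne_0[OF z]
  define N where "N x = exp (- (x * z)) * (Digamma x + euler_mascheroni) + inv_remainder (- z) x" for x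
  \<comment> \<open>J is the mean of N over [1, 2]. The integral of exp (- t z) brings a factor 1 -
    exp (- z), so after the division only gamma * exp (- z) / z is left of its second
    summand.\<close>
  define J where "J = digamma_transform z + euler_mascheroni * exp (- z) * (1 - exp (- z)) / z"
  define B where "B x = (N x - J) * (1 / (1 - exp (- z)))" for x
  have m: "((\<lambda>t. exp (- (of_real t * z))) has_integral (exp (- z) * (1 - exp (- z)) / z)) {1..2}"
  proof -
    have "((\<lambda>t. exp (- (of_real t * z))) has_integral (- exp (- (of_real 2 * z)) / z - (- exp (- (of_real 1 * z)) / z))) {1..2}"
      by (rule has_integral_FTC_complex) (use z in \<open>auto intro!: derivative_eq_intros\<close>)
    moreover have "exp (- (2 * z)) = exp (- z) * exp (- z)" by (simp flip: exp_add)
    ultimately show ?thesis by (simp add: algebra_simps diff_divide_distrib)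
  qed
  have "((\<lambda>t. N (of_real t)) has_integral (digamma_transform z + euler_mascheroni * (exp (- z) * (1 - exp (- z)) / z) + 0)) {1..2}"
    unfolding N_def distrib_left
    by (intro has_integral_add digamma_transform_has_integral inv_remainder_has_integral z2)
       (use has_integral_mult_right[OF m, of euler_mascheroni] in \<open>simp add: mult.commute\<close>)
  then have "((\<lambda>t. N (of_real t)) has_integral J) {1..2}" by (simp add: J_def mult.assoc)
  then have "((\<lambda>t. N (of_real t) - J) has_integral (J - (2 - 1) *\<^sub>R J)) {1..2}"
    by (rule has_integral_diff) (use has_integral_const_real[of J 1 2] in simp)
  then have "((\<lambda>t. (N (of_real t) - J) * (1 / (1 - exp (- z)))) has_integral ((J - (2 - 1) *\<^sub>R J) * (1 / (1 - exp (- z))))) {1..2}"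
    by (rule has_integral_mult_left)
  then have int: "((\<lambda>t. B (of_real t)) has_integral 0) {1..2}" by (simp add: B_def)
  have diff: "B x - B (x + 1) = exp (- (x * z)) * harm_interp x" if x: "x \<in> right_half_plane" for x
  proof -
    have "N x - N (x + 1) = exp (- (x * z)) * (Digamma x + euler_mascheroni)
        - exp (- ((x + 1) * z)) * (Digamma (x + 1) + euler_mascheroni) + (inv_remainder (- z) x - inv_remainder (- z) (x + 1))"
      by (simp add: N_def)
    also have "\<dots> = exp (- (x * z)) * (Digamma x + euler_mascheroni)
        - exp (- (x * z)) * exp (- z) * (Digamma x + 1 / x + euler_mascheroni) + exp (- (x * z)) / x"
      unfolding inv_remainder_diff[OF z2 x] Digamma_plus1[OF rhp_D(1)[OF x]]
      by (simp add: distrib_right flip: exp_add)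
    also have "\<dots> = exp (- (x * z)) * harm_interp x * (1 - exp (- z))"
      unfolding harm_interp_eq[OF rhp_D(1)[OF x]]
      by (simp add: algebra_simps diff_divide_distrib add_divide_distrib)
    finally have "(N x - N (x + 1)) * (1 / (1 - exp (- z))) = exp (- (x * z)) * harm_interp x" using nz by simp
    moreover have "B x - B (x + 1) = (N x - N (x + 1)) * (1 / (1 - exp (- z)))"
      by (simp add: B_def diff_divide_distrib)
    ultimately show ?thesis by simp
  qed
  have hol: "B holomorphic_on right_half_plane"
    unfolding B_def N_def by (intro holomorphic_intros holomorphic_inv_remainder z2) (auto dest: rhp_D)
  have "growth 1 (norm z) N"
  proof -
    have "growth (0 + 1) (norm (- z) + 0) (\<lambda>x. exp (x * (- z)) * (Digamma x + euler_mascheroni))"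
      by (intro growth_mult growth_exp growth_Digamma_plus_const)
    then have "growth 1 (norm z) (\<lambda>x. exp (- (x * z)) * (Digamma x + euler_mascheroni))" by simp
    moreover have "growth 1 (norm z) (inv_remainder (- z))" using growth_inv_remainder[OF z2] by simp
    ultimately show ?thesis unfolding N_def by (rule growth_add)
  qed
  moreover have "growth 1 (norm z) (\<lambda>_. - J)" by (rule growth_mono[OF growth_const]) auto
  ultimately have "growth 1 (norm z) (\<lambda>x. N x + (- J))" by (rule growth_add)
  from growth_mult[OF this growth_const[of "1 / (1 - exp (- z))"]]
  have "growth 1 (norm z) B" by (simp add: B_def[abs_def])
  then have "exp_type_less (2 * pi) B" using z2 by (intro growth_imp_exp_type) auto
  with int diff hol have "ramanujan_remainder (\<lambda>x. exp (- (x * z)) * harm_interp x) B"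
    by (simp add: ramanujan_remainder_def)
  then have "ramanujan_sum (\<lambda>x. exp (- (x * z)) * harm_interp x) = B 1"
    by (intro ramanujan_sum_eqI ramanujan_admissible_harm z)
  \<comment> \<open>As Digamma 1 = - gamma, the first summand of N vanishes at 1, and gamma enters N
    1 only through \<open>inv_remainder (- z) 1\<close>.\<close>
  also have N1: "N 1 = rem_series (- z) 1 + euler_mascheroni"
    using inv_remainder_1[OF z2] by (simp add: N_def)
  then have "B 1 = (euler_mascheroni + rem_series (- z) 1 - digamma_transform z) / (1 - exp (- z)) - euler_mascheroni * exp (- z) / z"
  proof -
    have "a * D / z * (1 / D) = a / z" if "D \<noteq> 0" for a D :: complex using that by simp
    from this[OF nz(2)] N1 show ?thesis
      by (simp add: B_def J_def diff_divide_distrib add_divide_distrib)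
  qed
  finally show ?thesis .
qed

text \<open>The two preceding formulas divide by 1 - exp (- z), so both remainders are constructed
  afresh here. The logarithmic sum L is never evaluated; it cancels against the mean of x * Digamma
  x.\<close>

lemma ramanujan_sum_at_0:
  "ramanujan_sum (\<lambda>x. exp (x * 0) * ln x) + ramanujan_sum (\<lambda>x. exp (- (x * 0)) * harm_interp x)
    = 3 / 2 * euler_mascheroni - 1 / 2"
proof -
  have z2: "norm (0 :: complex) < 2 * pi" by simp
  have inv0: "inv_remainder 0 x = - Digamma x" for x by (simp add: inv_remainder_def rem_series_0_left)
  obtain P where P: "\<And>x. x \<in> right_half_plane \<Longrightarrow> (P has_field_derivative exp (- (x * 0)) * inv_remainder 0 x) (at x)"
    and P1: "P 1 = 0" using inv_remainder_primitive[OF z2] by blast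
  have P': "(P has_field_derivative - Digamma x) (at x)" if "x \<in> right_half_plane" for x
    using P[OF that] by (simp add: inv0)
  have P2: "P 2 = 0"
  proof -
    have "((\<lambda>t. - Digamma (of_real t)) has_integral (P (of_real 2) - P (of_real 1))) {1..2}"
      by (rule has_integral_FTC_complex) (auto intro: P' of_real_in_rhp)
    moreover have "((\<lambda>t. - Digamma (complex_of_real t)) has_integral (- 0)) {1..2}"
      by (intro has_integral_neg has_integral_Digamma)
    ultimately have "P (of_real 2) - P (of_real 1) = - 0" by (rule has_integral_unique)
    then show ?thesis using P1 by simp
  qed
  \<comment> \<open>At z = 0 the condition on the constant reads P 2 = P 1. It holds already and
    leaves the constant free, so the constant must be fixed by the mean instead.\<close>
  define L where "L = - integral {1..2} (\<lambda>t. P (of_real t))"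
  have contP: "continuous_on right_half_plane P"
    using P' by (auto intro!: continuous_at_imp_continuous_on DERIV_isCont)
  have intP: "((\<lambda>t. P (of_real t)) has_integral (- L)) {1..2}"
    unfolding L_def by (simp, intro integrable_integral integrable_continuous_interval continuous_on_compose2[OF contP] continuous_intros)
      (auto intro: of_real_in_rhp)
  have "exp 0 * (L + P 2) = L + P 1" by (simp add: P1 P2)
  note sol = ln_solution_remainder[OF z2 P this]
  have "((\<lambda>t. L + P (of_real t)) has_integral ((2 - 1) *\<^sub>R L + (- L))) {1..2}"
    by (intro has_integral_add intP) (use has_integral_const_real[of L 1 2] in auto)
  moreover have "(2 - 1) *\<^sub>R L + (- L) = 0" by simp
  ultimately have "((\<lambda>t. exp (of_real t * 0) * (L + P (of_real t))) has_integral 0) {1..2}"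
    by (simp only: mult_zero_right exp_zero mult_1_left)
  then have "ramanujan_remainder (\<lambda>x. exp (x * 0) * ln x) (\<lambda>x. exp (x * 0) * (L + P x))"
    by (rule sol[rotated])
  then have "ramanujan_sum (\<lambda>x. exp (x * 0) * ln x) = exp (1 * 0) * (L + P 1)"
    using ramanujan_admissible_ln[of 0] by (intro ramanujan_sum_eqI) auto
  then have 1: "ramanujan_sum (\<lambda>x. exp (x * 0) * ln x) = L" using P1 by simp
  \<comment> \<open>In B below, the difference of - x * Digamma x is Digamma x + 1 + 1 / x, and the
    linear term corrects 1 to gamma. The means of these two parts are L and (1 - gamma) * 3 / 2, and
    c cancels them.\<close>
  define c where "c = - L - (1 - euler_mascheroni) * (3 / 2)"
  define B where "B x = - x * Digamma x + (1 - euler_mascheroni) * x + c" for x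
  have "ramanujan_remainder (\<lambda>x. exp (- (x * 0)) * harm_interp x) B"
    unfolding ramanujan_remainder_def
  proof (intro conjI ballI)
    show "B holomorphic_on right_half_plane"
      unfolding B_def by (intro holomorphic_intros) (auto dest: rhp_D)
    show "B x - B (x + 1) = exp (- (x * 0)) * harm_interp x" if x: "x \<in> right_half_plane" for x
      unfolding B_def harm_interp_eq[OF rhp_D(1)[OF x]] Digamma_plus1[OF rhp_D(1)[OF x]]
      using rhp_D(1)[OF x] by (simp add: field_simps)
    have "growth 2 0 (\<lambda>x. (-1) * (x * Digamma x) + ((1 - euler_mascheroni) * x + c))"
    proof (intro growth_add)
      show "growth 2 0 (\<lambda>x. (-1) * (x * Digamma x))"
        by (rule growth_mono[OF growth_mult[OF growth_const growth_mult[OF growth_ident growth_Digamma]]]) auto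
      show "growth 2 0 (\<lambda>x. (1 - euler_mascheroni) * x)"
        by (rule growth_mono[OF growth_mult[OF growth_const growth_ident]]) auto
      show "growth 2 0 (\<lambda>x. c)" by (rule growth_mono[OF growth_const]) auto
    qed
    moreover have "B = (\<lambda>x. (-1) * (x * Digamma x) + ((1 - euler_mascheroni) * x + c))"
      by (simp add: B_def fun_eq_iff)
    ultimately have "growth 2 0 B" by (simp only:)
    then show "exp_type_less (2 * pi) B" by (rule growth_imp_exp_type) simp
    \<comment> \<open>Integration by parts: x * P x vanishes at 1 and at 2, so - t * Digamma t has
      minus the integral of P, which is L.\<close>
    have "((\<lambda>t. of_real t * (- Digamma (of_real t)) + P (of_real t)) has_integral (of_real 2 * P (of_real 2) - of_real 1 * P (of_real 1))) {1..2}"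
      by (rule has_integral_FTC_complex[where F = "\<lambda>x. x * P x"])
         (auto intro!: derivative_eq_intros P' of_real_in_rhp)
    from has_integral_diff[OF this intP]
    have "((\<lambda>t. - of_real t * Digamma (complex_of_real t)) has_integral L) {1..2}" by (simp add: P1 P2)
    moreover have "((\<lambda>t. (1 - euler_mascheroni) * complex_of_real t) has_integral
       ((1 - euler_mascheroni) * of_real 2 ^ 2 / 2 - (1 - euler_mascheroni) * of_real 1 ^ 2 / 2)) {1..2}"
      by (rule has_integral_FTC_complex[where F = "\<lambda>x. (1 - euler_mascheroni) * x ^ 2 / 2"])
         (auto intro!: derivative_eq_intros)
    moreover have "((\<lambda>t. c) has_integral ((2 - 1) *\<^sub>R c)) {1..2::real}"
      using has_integral_const_real[of c 1 2] by simp
    ultimately have "((\<lambda>t. B (of_real t)) has_integral (L +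
       ((1 - euler_mascheroni) * of_real 2 ^ 2 / 2 - (1 - euler_mascheroni) * of_real 1 ^ 2 / 2) + (2 - 1) *\<^sub>R c)) {1..2}"
      unfolding B_def by (intro has_integral_add)
    then show "((\<lambda>t. B (of_real t)) has_integral 0) {1..2}"
      by (simp add: c_def field_simps)
  qed
  then have 2: "ramanujan_sum (\<lambda>x. exp (- (x * 0)) * harm_interp x) = B 1"
    using ramanujan_admissible_harm[of 0] by (intro ramanujan_sum_eqI) auto
  show ?thesis unfolding 1 2 by (simp add: B_def c_def field_simps)
qed

section \<open>Rational power series\<close>

definition rat_powser :: "(complex \<Rightarrow> complex) \<Rightarrow> bool" where
  "rat_powser f \<longleftrightarrow> (\<exists>q. (\<forall>n. q n \<in> \<rat>) \<and> (\<forall>z. norm z < pi \<longrightarrow> (\<lambda>n. q n * z ^ n) sums f z))"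

lemma rat_powserI:
  "(\<And>n. q n \<in> \<rat>) \<Longrightarrow> (\<And>z. norm z < pi \<Longrightarrow> (\<lambda>n. q n * z ^ n) sums f z) \<Longrightarrow> rat_powser f"
  unfolding rat_powser_def by blast

lemma rat_powser_mult:
  assumes "rat_powser f" "rat_powser g"
  shows "rat_powser (\<lambda>z. f z * g z)"
proof -
  obtain p q where p: "\<And>n. p n \<in> \<rat>" "\<And>z. norm z < pi \<Longrightarrow> (\<lambda>n. p n * z ^ n) sums f z"
    and q: "\<And>n. q n \<in> \<rat>" "\<And>z. norm z < pi \<Longrightarrow> (\<lambda>n. q n * z ^ n) sums g z"
    using assms unfolding rat_powser_def by metis
  show ?thesis
  proof (rule rat_powserI)
    show "(\<Sum>i\<le>n. p i * q (n - i)) \<in> \<rat>" for n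
      using p q by (intro Rats_sum Rats_mult) auto
    fix z :: complex assume z: "norm z < pi"
    \<comment> \<open>Convergence at the larger radius s gives the absolute convergence that the
      Cauchy product needs.\<close>
    obtain s where s: "norm z < s" "s < pi" using dense z by blast
    have s0: "s > 0" using s norm_ge_zero[of z] by linarith
    have "summable (\<lambda>n. norm (p n * z ^ n))"
      by (rule powser_insidea[of _ "of_real s"]) (use p(2)[of "of_real s"] s s0 in \<open>auto simp: sums_iff\<close>)
    moreover have "summable (\<lambda>n. norm (q n * z ^ n))"
      by (rule powser_insidea[of _ "of_real s"]) (use q(2)[of "of_real s"] s s0 in \<open>auto simp: sums_iff\<close>)
    ultimately have "(\<lambda>n. \<Sum>i\<le>n. (p i * z ^ i) * (q (n - i) * z ^ (n - i))) sums
        ((\<Sum>n. p n * z ^ n) * (\<Sum>n. q n * z ^ n))"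
      by (rule Cauchy_product_sums)
    moreover have "(\<Sum>i\<le>n. (p i * z ^ i) * (q (n - i) * z ^ (n - i))) = (\<Sum>i\<le>n. p i * q (n - i)) * z ^ n" for n
      unfolding sum_distrib_right
    proof (rule sum.cong)
      fix i assume "i \<in> {..n}"
      then have "z ^ n = z ^ i * z ^ (n - i)" by (simp add: power_add[symmetric])
      then show "(p i * z ^ i) * (q (n - i) * z ^ (n - i)) = p i * q (n - i) * z ^ n" by simp
    qed simp
    ultimately show "(\<lambda>n. (\<Sum>i\<le>n. p i * q (n - i)) * z ^ n) sums (f z * g z)"
      using sums_unique[OF p(2)[OF z]] sums_unique[OF q(2)[OF z]] by simp
  qed
qed

lemma rat_powser_exp: "rat_powser exp"
proof (rule rat_powserI)
  show "1 / fact n \<in> (\<rat> :: complex set)" for n by (intro Rats_divide) auto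
  show "(\<lambda>n. 1 / fact n * z ^ n) sums exp z" for z :: complex
    using exp_converges[of z] by (simp add: scaleR_conv_of_real divide_inverse)
qed

lemma rat_powser_bern_fun_neg: "rat_powser (\<lambda>z. bern_fun (- z))"
proof (rule rat_powserI)
  show "fps_nth bernF n * (-1) ^ n \<in> \<rat>" for n
    by (intro Rats_mult Rats_power bernF_nth_rat) auto
  show "(\<lambda>n. fps_nth bernF n * (-1) ^ n * z ^ n) sums bern_fun (- z)" if "norm z < pi" for z
  proof -
    have "norm (- z) < 2 * pi" using that pi_gt_zero unfolding norm_minus_cancel by linarith
    from bern_fun_sums[OF this] show ?thesis by (simp add: power_minus[of z] mult.assoc)
  qed
qed

text \<open>This is needed for the value at 0 of the right-hand side once its singularity is
  removed.\<close>

lemma bern_fun_neg_deriv: "((\<lambda>z. bern_fun (- z)) has_field_derivative - (1 / 2)) (at 0)"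
proof -
  have "(\<lambda>n. diffs (fps_nth bernF) n * 0 ^ n) sums diffs (fps_nth bernF) 0"
    using powser_sums_zero by blast
  then have d: "(\<Sum>n. diffs (fps_nth bernF) n * 0 ^ n) = 1 / 2"
    using bernF_nth_1 by (simp add: sums_iff diffs_def)
  have "((\<lambda>z. \<Sum>n. fps_nth bernF n * z ^ n) has_field_derivative (\<Sum>n. diffs (fps_nth bernF) n * 0 ^ n)) (at 0)"
    by (rule termdiffs_strong'[of "2 * pi"]) (use bern_fun_sums in \<open>auto simp: sums_iff\<close>)
  then have "(bern_fun has_field_derivative 1 / 2) (at 0)"
    unfolding d
    by (rule has_field_derivative_transform_within_open[where S = "ball 0 (2 * pi)"])
       (use bern_fun_sums in \<open>auto simp: sums_iff\<close>)
  then have "(bern_fun has_field_derivative 1 / 2) (at (- 0))" by simp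
  from DERIV_chain2[where f = bern_fun and g = uminus and x = 0, OF this DERIV_minus[OF DERIV_ident]]
  show ?thesis by simp
qed

lemma remove_sings_euler_term:
  fixes z :: complex
  assumes "norm z < pi"
  shows "remove_sings (\<lambda>w. euler_mascheroni * (exp w / (1 - exp (- w)) - 1 / w)) z =
    euler_mascheroni * (if z = 0 then 3 / 2 else exp z / (1 - exp (- z)) - 1 / z)"
proof (rule remove_sings_eqI, cases "z = 0")
  case False
  then have "1 - exp (- z) \<noteq> 0" using one_minus_exp_ne_0(2)[OF assms False] by simp
  then have "isCont (\<lambda>w. euler_mascheroni * (exp w / (1 - exp (- w)) - 1 / w)) z"
    using False by (intro continuous_intros) auto
  then show "(\<lambda>w. euler_mascheroni * (exp w / (1 - exp (- w)) - 1 / w)) \<midarrow>z\<rightarrow>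
      euler_mascheroni * (if z = 0 then 3 / 2 else exp z / (1 - exp (- z)) - 1 / z)"
    using False by (simp add: isCont_def)
next
  case True
  \<comment> \<open>For w \<noteq> 0, exp w / (1 - exp (- w)) is - u w / w, and u 0 = -1. So the
    bracket is minus the difference quotient of u at 0, and u' (0) = -1 - 1/2 gives the value
    3/2.\<close>
  define u where "u w = exp w * bern_fun (- w)" for w
  have "(u has_field_derivative (exp 0 * bern_fun (- 0) + - (1 / 2) * exp 0)) (at 0)"
    unfolding u_def by (rule DERIV_mult[OF DERIV_exp bern_fun_neg_deriv])
  then have "(\<lambda>w. (u w - u 0) / (w - 0)) \<midarrow>0\<rightarrow> - (3 / 2)"
    by (simp add: has_field_derivative_iff bern_fun_def)
  then have "(\<lambda>w. - euler_mascheroni * ((u w - u 0) / (w - 0))) \<midarrow>0\<rightarrow> - euler_mascheroni * (- (3 / 2))"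
    by (rule tendsto_mult_left)
  moreover have "\<forall>\<^sub>F w in at 0. - euler_mascheroni * ((u w - u 0) / (w - 0)) = euler_mascheroni * (exp w / (1 - exp (- w)) - 1 / w)"
  proof -
    have "- euler_mascheroni * ((u w - u 0) / (w - 0)) = euler_mascheroni * (exp w / (1 - exp (- w)) - 1 / w)" if "w \<noteq> 0" for w :: complex
    proof -
      have "(u w - u 0) / (w - 0) = (w * (- (exp w / (1 - exp (- w)))) + 1) / w"
        using that by (simp add: u_def bern_fun_def mult_ac)
      also have "\<dots> = - (exp w / (1 - exp (- w))) + 1 / w"
        using nonzero_mult_div_cancel_left[OF that, of "- (exp w / (1 - exp (- w)))"]
        by (simp only: add_divide_distrib)
      finally have "(u w - u 0) / (w - 0) = - (exp w / (1 - exp (- w))) + 1 / w" .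
      then show ?thesis by (simp only:) (simp add: algebra_simps)
    qed
    then show ?thesis by (auto simp: eventually_at_filter)
  qed
  ultimately have "(\<lambda>w. euler_mascheroni * (exp w / (1 - exp (- w)) - 1 / w)) \<midarrow>0\<rightarrow> - euler_mascheroni * (- (3 / 2) :: complex)"
    by (rule Lim_transform_eventually)
  then show "(\<lambda>w. euler_mascheroni * (exp w / (1 - exp (- w)) - 1 / w)) \<midarrow>z\<rightarrow>
      euler_mascheroni * (if z = 0 then 3 / 2 else exp z / (1 - exp (- z)) - 1 / z)"
    using True by simp
qed

text \<open>The numerator has no constant term, and 1/2 is its coefficient of z, so the case z = 0
  is the continuous extension.\<close>

definition sum_quotient :: "complex \<Rightarrow> complex" where
  "sum_quotient z = (if z = 0 then 1 / 2 else (twist_integral z - rem_series (- z) 1) / z)"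

lemma rat_powser_sum_quotient: "rat_powser sum_quotient"
proof (rule rat_powserI)
  define q where "q n = integral {1..2} (\<lambda>t. twist_coeff n (of_real t)) - rem_coeff n 1 * (-1) ^ n" for n
  \<comment> \<open>The division by z shifts the coefficients by one; this loses nothing because q 0
    = 0.\<close>
  show "q (Suc n) \<in> \<rat>" for n
  proof -
    have "rem_coeff m 1 \<in> \<rat>" for m
      unfolding rem_coeff_def bern_poly_def
      by (intro Rats_divide Rats_add Rats_sum Rats_mult Rats_power bernF_nth_rat) auto
    then show ?thesis unfolding q_def
      by (intro Rats_diff twist_coeff_integral_rat Rats_mult Rats_power) auto
  qed
  have q0: "q 0 = 0" and q1: "q 1 = 1 / 2"
    unfolding q_def twist_coeff_integral_0 twist_coeff_integral_1 rem_coeff_1 by (simp_all add: rem_coeff_0)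
  fix z :: complex assume z: "norm z < pi"
  then have z2: "norm z < 2 * pi" "norm (- z) < 2 * pi" using pi_gt_zero unfolding norm_minus_cancel by linarith+
  have "(\<lambda>n. rem_coeff n 1 * (-1) ^ n * z ^ n) sums rem_series (- z) 1"
    using rem_series_sums[OF z2(2), of 1] by (simp add: power_minus[of z] mult.assoc)
  from sums_diff[OF twist_integral_sums[OF z2(1)] this]
  have s: "(\<lambda>n. q n * z ^ n) sums (twist_integral z - rem_series (- z) 1)"
    by (simp add: q_def left_diff_distrib)
  show "(\<lambda>n. q (Suc n) * z ^ n) sums sum_quotient z"
  proof (cases "z = 0")
    case True
    then show ?thesis using powser_sums_zero[of "\<lambda>n. q (Suc n)"] q1 by (simp add: sum_quotient_def)
  next
    case False
    have "(\<lambda>n. q (Suc n) * z ^ Suc n) sums (twist_integral z - rem_series (- z) 1)"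
      using s by (subst sums_Suc_iff) (simp add: q0)
    from sums_divide[OF this, of z] show ?thesis using False by (simp add: sum_quotient_def)
  qed
qed

text \<open>For z \<noteq> 0 what survives the cancellation is exp z * (rem_series (- z) 1 -
  twist_integral z) / (1 - exp (- z)). Splitting off z / (1 - exp (- z)) leaves factors that are
  power series also at 0. There both sides are -1/2: the direct value 3/2 gamma - 1/2 less the
  removed singularity's 3/2 gamma.\<close>

lemma ramanujan_sums_combined:
  assumes z: "norm z < pi"
  shows "ramanujan_sum (\<lambda>x. exp (x * z) * ln x)
       + exp z * ramanujan_sum (\<lambda>x. exp (- (x * z)) * harm_interp x)
       - remove_sings (\<lambda>w. euler_mascheroni * (exp w / (1 - exp (- w)) - 1 / w)) z
     = exp z * (bern_fun (- z) * sum_quotient z)"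
proof (cases "z = 0")
  case True
  show ?thesis
    unfolding remove_sings_euler_term[OF z] using True ramanujan_sum_at_0 by (simp add: bern_fun_def sum_quotient_def)
next
  case False
  define w where "w = inverse (1 - exp (- z))"
  have e: "exp z * exp (- z) = 1" by (simp flip: exp_add)
  have "exp z * ramanujan_sum (\<lambda>x. exp (- (x * z)) * harm_interp x)
     = exp z * ((euler_mascheroni + rem_series (- z) 1 - digamma_transform z) * w) - euler_mascheroni * (exp z * exp (- z)) / z"
    unfolding ramanujan_sum_harm[OF z False] w_def by (simp add: right_diff_distrib divide_inverse mult_ac)
  then have h: "exp z * ramanujan_sum (\<lambda>x. exp (- (x * z)) * harm_interp x)
     = exp z * ((euler_mascheroni + rem_series (- z) 1 - digamma_transform z) * w) - euler_mascheroni / z"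
    unfolding e by simp
  have l: "ramanujan_sum (\<lambda>x. exp (x * z) * ln x) = exp z * (digamma_transform z - twist_integral z) * w"
    unfolding ramanujan_sum_ln[OF z False] w_def by (simp add: divide_inverse)
  have r: "remove_sings (\<lambda>w. euler_mascheroni * (exp w / (1 - exp (- w)) - 1 / w)) z = euler_mascheroni * (exp z * w - 1 / z)"
    unfolding remove_sings_euler_term[OF z] w_def using False by (simp add: divide_inverse)
  have "bern_fun (- z) * sum_quotient z = (rem_series (- z) 1 - twist_integral z) * w"
  proof -
    have "bern_fun (- z) = - z * w" using False by (simp add: bern_fun_def w_def divide_inverse)
    then have "bern_fun (- z) * sum_quotient z = - z * w * ((twist_integral z - rem_series (- z) 1) / z)"
      using False by (simp only: sum_quotient_def if_False)
    also have "\<dots> = - (w * (twist_integral z - rem_series (- z) 1))" using False by simp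
    also have "\<dots> = (rem_series (- z) 1 - twist_integral z) * w" by (simp add: algebra_simps)
    finally show ?thesis .
  qed
  then show ?thesis unfolding h l r by (simp only:) (simp add: algebra_simps)
qed

theorem theorem1:
  shows "\<exists>q :: nat \<Rightarrow> rat. \<forall>z :: complex. norm z < pi \<longrightarrow>
    (\<lambda>n. of_rat (q n) * z ^ n) sums
      (ramanujan_sum (\<lambda>x. exp (x * z) * ln x)
       + exp z * ramanujan_sum (\<lambda>x. exp (- (x * z)) * harm_interp x)
       - remove_sings (\<lambda>w. euler_mascheroni * (exp w / (1 - exp (- w)) - 1 / w)) z)"
proof -
  have "rat_powser (\<lambda>z. exp z * (bern_fun (- z) * sum_quotient z))"
    by (intro rat_powser_mult rat_powser_exp rat_powser_bern_fun_neg rat_powser_sum_quotient)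
  then obtain c where c: "\<And>n. c n \<in> \<rat>"
    "\<And>z. norm z < pi \<Longrightarrow> (\<lambda>n. c n * z ^ n) sums (exp z * (bern_fun (- z) * sum_quotient z))"
    unfolding rat_powser_def by blast
  have "\<forall>n. \<exists>r. c n = of_rat r" using c(1) by (auto elim: Rats_cases)
  then obtain q where "\<And>n. c n = of_rat (q n)" by metis
  with c(2) ramanujan_sums_combined show ?thesis by (intro exI[of _ q]) auto
qed

end
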